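(* Let $A\in\mathbb{H}^{n}_{\sup}$ and $B\in\mathbb{H}^{n\times m}_{\sup}$. Let $\mathcal{M}=[\tau_{\min},\tau_{\max}]^p$ be divided into $N$ disjoint boxes $\{\mathcal{B}_i\}_{i=1}^N$ with union $\mathcal{M}$, and let $c_i\in\mathcal{B}_i$ for each $i$. For each $i=1,\dots,N$ define $$w_i(\phi):=\int_{\mathcal{B}_i}g(\phi,\ell)\,\mu(d\ell)\ \ge 0\qquad\forall\phi\in\mathcal{M},$$ $$\begin{bmatrix}\Gamma_{A,i}&\Gamma_{B,i}\end{bmatrix}:=\begin{bmatrix}\sqrt{w_1(c_i)}A(c_i)&\sqrt{w_1(c_i)}B(c_i)\\ \vdots&\vdots\\ \sqrt{w_N(c_i)}A(c_i)&\sqrt{w_N(c_i)}B(c_i)\end{bmatrix}.$$ Assume that for every $i=1,\dots,N$ a scalar $\kappa_i>0$ satisfies $$\left\|\begin{bmatrix}\sqrt{w_1(\phi)}A(\phi)&\sqrt{w_1(\phi)}B(\phi)\\ \vdots&\vdots\\ \sqrt{w_N(\phi)}A(\phi)&\sqrt{w_N(\phi)}B(\phi)\end{bmatrix}-\begin{bmatrix}\Gamma_{A,i}&\Gamma_{B,i}\end{bmatrix}\right\|\le\kappa_i$$ for $\mu$-almost every $\phi\in\mathcal{B}_i$. If there exist positive definite matrices $R_i\in\mathbb{R}^{n\times n}$, (not necessarily symmetric) matrices $U_i\in\mathbb{R}^{n\times n}$, $\bar F_i\in\mathbb{R}^{m\times n}$, and scalars $\lambda_i>0$ such that the linear matrix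 inequalities $$\begin{bmatrix}U_i+U_i^{\top}-R_i&0&U_i^{\top}\Gamma_{A,i}^{\top}+\bar F_i^{\top}\Gamma_{B,i}^{\top}&\kappa_i\begin{bmatrix}U_i^{\top}&\bar F_i^{\top}\end{bmatrix}\\ \star&\lambda_iI&\lambda_iI&0\\ \star&\star&\bm{R}&0\\ \star&\star&\star&\lambda_iI\end{bmatrix}>0$$ hold for all $i=1,\dots,N$, where $\bm{R}:=\mathrm{diag}(R_1,\dots,R_N)$, then the pair $(A,B)$ is stochastically stabilizable by the piecewise-constant gain $F\in\mathbb{H}^{m\times n}_{\sup}$ defined by $F(\phi):=F_i$ for $\phi\in\mathcal{B}_i$, with $F_i:=\bar F_iU_i^{-1}$.
   Context: $\mathcal{M}=[\tau_{\min},\tau_{\max}]^p\subset\mathbb{R}^p$, with its Borel $\sigma$-algebra and a $\sigma$-finite measure $\mu$. $g(\cdot,\cdot)$ is the transition density with respect to $\mu$ of a time-homogeneous Markov chain $\{\phi_k\}$ in $\mathcal{M}$: $P(\phi_{k+1}\in\mathcal{B}\mid\phi_k=\phi)=\int_{\mathcal{B}}g(\phi,\ell)\mu(d\ell)$ for all Borel $\mathcal{B}\subset\mathcal{M}$. A box is a product of $p$ intervals. $\mathbb{H}^{n\times m}_{\sup}$ is the space of measurable, essentially bounded functions $\mathcal{M}\to\mathbb{R}^{n\times m}$, and $\mathbb{H}^n_{\sup}:=\mathbb{H}^{n\times n}_{\sup}$. $\mathbb{H}^n_{1,\mathbb{C}}$ is the space of measurable, $\mu$-integrable functions $\mathcal{M}\to\mathbb{C}^{n\times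 n}$. For $A\in\mathbb{H}^n_{\sup}$ define $\mathcal{L}_A:\mathbb{H}^n_{1,\mathbb{C}}\to\mathbb{H}^n_{1,\mathbb{C}}$ by $$\mathcal{L}_A(V)(\cdot):=\int_{\mathcal{M}}g(\ell,\cdot)A(\ell)V(\ell)A(\ell)^{\top}\mu(d\ell),$$ and let $r_\sigma$ denote the spectral radius. $(A,B)$ is stochastically stabilizable if there is $F\in\mathbb{H}^{m\times n}_{\sup}$ with $r_\sigma(\mathcal{L}_{A+BF})<1$; in that case $(A,B)$ is said to be stochastically stabilizable by $F$ ($F$ stochastically stabilizes $(A,B)$). $\|\cdot\|$ is the matrix norm induced by the Euclidean norm; $\star$ denotes blocks determined by symmetry; $>0$ means symmetric positive definite. Block sizes in the inequality are $n$, $nN$, $nN$, $n+m$. *)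

theory Defs
  imports "HOL-Probability.Probability"
begin

text \<open>The norm induced by the Euclidean norm.  The library's \<open>norm\<close> on matrices is
  the Frobenius norm.\<close>

definition mat_norm :: "'a::real_normed_field^'n^'m \<Rightarrow> real" where
  "mat_norm A = onorm (\<lambda>x. A *v x)"

definition pos_def :: "real^'n^'n \<Rightarrow> bool" where
  "pos_def P \<longleftrightarrow> transpose P = P \<and> (\<forall>x. x \<noteq> 0 \<longrightarrow> 0 < x \<bullet> (P *v x))"

text \<open>Block matrices are indexed by sum types (blocks of different kinds) and by product types
  \<open>'k \<times> 'n\<close> (\<open>CARD('k)\<close> blocks of size \<open>CARD('n)\<close>).\<close>

definition hcat :: "'a^'c::finite^'r \<Rightarrow> 'a^'d::finite^'r \<Rightarrow> 'a^('c + 'd)^'r" where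
  "hcat A B = (\<chi> r s. case s of Inl c \<Rightarrow> A $ r $ c | Inr d \<Rightarrow> B $ r $ d)"

definition vcat :: "'a^'c^'r::finite \<Rightarrow> 'a^'c^'s::finite \<Rightarrow> 'a^'c^('r + 's)" where
  "vcat A B = (\<chi> r. case r of Inl i \<Rightarrow> A $ i | Inr j \<Rightarrow> B $ j)"

text \<open>\<open>sym_block P Q S\<close> is the matrix with rows \<open>(P, Q)\<close> and \<open>(Q\<^sup>T, S)\<close>.\<close>

definition sym_block ::
  "real^'r::finite^'r \<Rightarrow> real^'s::finite^'r \<Rightarrow> real^'s^'s \<Rightarrow> real^('r + 's)^('r + 's)" where
  "sym_block P Q S = vcat (hcat P Q) (hcat (transpose Q) S)"

definition block_diag :: "('k::finite \<Rightarrow> real^'n^'n) \<Rightarrow> real^('k \<times> 'n)^('k \<times> 'n)" where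
  "block_diag R = (\<chi> r s. if fst r = fst s then R (fst r) $ snd r $ snd s else 0)"

definition weighted_stack :: "('k::finite \<Rightarrow> real) \<Rightarrow> real^'c^'n \<Rightarrow> real^'c^('k \<times> 'n)" where
  "weighted_stack v A = (\<chi> r. sqrt (v (fst r)) *\<^sub>R A $ snd r)"

text \<open>Rows and columns are grouped as \<open>n + (nN + (nN + (n + m)))\<close>, so the upper triangle is
  built from nested symmetric blocks.\<close>

definition lmi_matrix ::
  "real^'n^'n \<Rightarrow> real^'n^'n \<Rightarrow> real^'n^'m \<Rightarrow> real^'n^('k::finite \<times> 'n) \<Rightarrow> real^'m^('k \<times> 'n) \<Rightarrow>
   real \<Rightarrow> real \<Rightarrow> real^('k \<times> 'n)^('k \<times> 'n) \<Rightarrow>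
   real^('n + ('k \<times> 'n) + ('k \<times> 'n) + ('n + 'm))^('n + ('k \<times> 'n) + ('k \<times> 'n) + ('n + 'm))"
  where
  "lmi_matrix R U Fb GA GB kap lam RR =
    sym_block (U + transpose U - R)
      (hcat 0 (hcat (transpose U ** transpose GA + transpose Fb ** transpose GB)
                    (kap *\<^sub>R hcat (transpose U) (transpose Fb))))
      (sym_block (lam *\<^sub>R mat 1) (hcat (lam *\<^sub>R mat 1) 0)
        (sym_block RR 0 (lam *\<^sub>R mat 1)))"

definition param_cube :: "real \<Rightarrow> real \<Rightarrow> (real^'p) set" where
  "param_cube a b = {x. \<forall>i. x $ i \<in> {a..b}}"

definition is_box :: "(real^'p) set \<Rightarrow> bool" where
  "is_box S \<longleftrightarrow> (\<exists>I. (\<forall>i. is_interval (I i)) \<and> S = {x. \<forall>i. x $ i \<in> I i})"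

text \<open>\<open>density \<mu> (g x)\<close> is the conditional law of the next state given the current state \<open>x\<close>.\<close>

definition transition_density :: "'a measure \<Rightarrow> ('a \<Rightarrow> 'a \<Rightarrow> real) \<Rightarrow> bool" where
  "transition_density \<mu> g \<longleftrightarrow>
     (\<lambda>(x, y). g x y) \<in> borel_measurable (\<mu> \<Otimes>\<^sub>M \<mu>) \<and>
     (\<forall>x\<in>space \<mu>. \<forall>y\<in>space \<mu>. 0 \<le> g x y) \<and>
     (\<forall>x\<in>space \<mu>. prob_space (density \<mu> (\<lambda>y. ennreal (g x y))))"

definition H_sup :: "'a measure \<Rightarrow> ('a \<Rightarrow> real^'m^'n) set" where
  "H_sup \<mu> = {A \<in> borel_measurable \<mu>. \<exists>c. AE x in \<mu>. mat_norm (A x) \<le> c}"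

text \<open>The elements are functions rather than classes modulo equality almost everywhere; operators
  on this space are accordingly compared up to equality almost everywhere.\<close>

definition H1C :: "'a measure \<Rightarrow> ('a \<Rightarrow> complex^'n^'n) set" where
  "H1C \<mu> = {V. integrable \<mu> V}"

definition H1C_norm :: "'a measure \<Rightarrow> ('a \<Rightarrow> complex^'n^'n) \<Rightarrow> real" where
  "H1C_norm \<mu> V = (\<integral>x. mat_norm (V x) \<partial>\<mu>)"

definition cscale :: "complex \<Rightarrow> complex^'n^'m \<Rightarrow> complex^'n^'m" where
  "cscale z V = map_matrix (\<lambda>v. z * v) V"

definition H1C_bounded_linear ::
  "'a measure \<Rightarrow> (('a \<Rightarrow> complex^'n^'n) \<Rightarrow> ('a \<Rightarrow> complex^'n^'n)) \<Rightarrow> bool" where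
  "H1C_bounded_linear \<mu> T \<longleftrightarrow>
     (\<forall>V\<in>H1C \<mu>. T V \<in> H1C \<mu>) \<and>
     (\<forall>V\<in>H1C \<mu>. \<forall>W\<in>H1C \<mu>. AE x in \<mu>. T (\<lambda>y. V y + W y) x = T V x + T W x) \<and>
     (\<forall>z. \<forall>V\<in>H1C \<mu>. AE x in \<mu>. T (\<lambda>y. cscale z (V y)) x = cscale z (T V x)) \<and>
     (\<exists>C. \<forall>V\<in>H1C \<mu>. H1C_norm \<mu> (T V) \<le> C * H1C_norm \<mu> V)"

text \<open>The points \<open>z\<close> at which \<open>z I - T\<close> has a bounded two-sided inverse \<open>S\<close>.\<close>

definition H1C_resolvent_set ::
  "'a measure \<Rightarrow> (('a \<Rightarrow> complex^'n^'n) \<Rightarrow> ('a \<Rightarrow> complex^'n^'n)) \<Rightarrow> complex set" where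
  "H1C_resolvent_set \<mu> T =
     {z. \<exists>S. H1C_bounded_linear \<mu> S \<and>
        (\<forall>V\<in>H1C \<mu>.
          (AE x in \<mu>. S (\<lambda>y. cscale z (V y) - T V y) x = V x) \<and>
          (AE x in \<mu>. cscale z (S V x) - T (S V) x = V x))}"

definition H1C_spectrum ::
  "'a measure \<Rightarrow> (('a \<Rightarrow> complex^'n^'n) \<Rightarrow> ('a \<Rightarrow> complex^'n^'n)) \<Rightarrow> complex set" where
  "H1C_spectrum \<mu> T = - H1C_resolvent_set \<mu> T"

definition H1C_spectral_radius ::
  "'a measure \<Rightarrow> (('a \<Rightarrow> complex^'n^'n) \<Rightarrow> ('a \<Rightarrow> complex^'n^'n)) \<Rightarrow> ennreal" where
  "H1C_spectral_radius \<mu> T = (SUP z\<in>H1C_spectrum \<mu> T. ennreal (cmod z))"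

text \<open>By nonnegativity and Tonelli, the integral exists for almost every \<open>x\<close> if \<open>A\<close> is essentially
  bounded and \<open>V\<close> integrable; elsewhere its value is 0.\<close>

definition L_op ::
  "'a measure \<Rightarrow> ('a \<Rightarrow> 'a \<Rightarrow> real) \<Rightarrow> ('a \<Rightarrow> real^'n^'n) \<Rightarrow>
   ('a \<Rightarrow> complex^'n^'n) \<Rightarrow> ('a \<Rightarrow> complex^'n^'n)" where
  "L_op \<mu> g A V = (\<lambda>x. \<integral>y. g y x *\<^sub>R
     (map_matrix complex_of_real (A y) ** V y ** transpose (map_matrix complex_of_real (A y))) \<partial>\<mu>)"

definition stoch_stabilizable_by ::
  "'a measure \<Rightarrow> ('a \<Rightarrow> 'a \<Rightarrow> real) \<Rightarrow> ('a \<Rightarrow> real^'n^'n) \<Rightarrow> ('a \<Rightarrow> real^'m^'n) \<Rightarrow>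
   ('a \<Rightarrow> real^'n^'m) \<Rightarrow> bool" where
  "stoch_stabilizable_by \<mu> g A B F \<longleftrightarrow>
     F \<in> H_sup \<mu> \<and> H1C_spectral_radius \<mu> (L_op \<mu> g (\<lambda>x. A x + B x ** F x)) < 1"

end

theory Submission
  imports Defs
begin

text \<open>
  Write \<open>K = A + B F\<close> for the closed loop and \<open>P i\<close> for the inverse of \<open>R i\<close>.  The matrix
  inequality, tested on well-chosen vectors, says that the function equal to \<open>P i\<close> on \<open>Box i\<close> is a
  Lyapunov function for the adjoint dynamics: for almost every \<open>\<phi>\<close> in \<open>Box i\<close> and every \<open>h\<close>,
  \<open>\<Sum>j. w j \<phi> * (K h \<bullet> P j (K h)) \<le> \<alpha> * (h \<bullet> P i h)\<close>, where \<open>\<alpha> < 1\<close> does not depend on \<open>\<phi>\<close>.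
  The \<open>\<kappa>\<close>-block of the inequality pays for the distance between the stacked matrices at \<open>\<phi>\<close> and
  at the centre of the box, by Young's inequality; strict definiteness leaves the margin
  \<open>1 - \<alpha>\<close>.  This is \<open>lmi_contraction\<close>, restated for the closed loop in
  \<open>closed_loop_contraction\<close>.

  The Lyapunov inequality controls positive semidefinite matrices, while the operator acts on all
  complex ones.  The step between the two is made by duality.  Call a real matrix field \<open>Q\<close>
  dominated at level \<open>t\<close> if \<open>2 * (u \<bullet> Q v) \<le> t * (u \<bullet> P u + v \<bullet> P v)\<close> for all real vectors \<open>u\<close>
  and \<open>v\<close>, almost everywhere.  The right-hand side is a sum of two expressions of the kind that
  the Lyapunov inequality bounds, so the adjoint of \<open>L_op\<close> maps level \<open>t\<close> to level \<open>\<alpha> * t\<close>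
  (\<open>dominated_L_dual\<close>).  Unit matrices multiplied by signs are dominated, and pairing with them
  recovers the \<open>L\<^sup>1\<close> norms of the real and imaginary parts of the entries; hence the \<open>k\<close>-th power
  of \<open>L_op\<close> has norm at most \<open>C * \<alpha> ^ k\<close> (\<open>L_op_funpow_decay\<close>).

  Finally, such a power bound makes the Neumann series \<open>\<Sum>k. (T ^^ k) V / z ^ (k + 1)\<close> converge whenever
  \<open>\<alpha> < cmod z\<close>, so that the spectral radius is at most \<open>\<alpha>\<close> (\<open>H1C_spectral_radius_le\<close>).
\<close>

section \<open>The induced matrix norm\<close>

lemma bounded_bilinear_matrix_vector:
  "bounded_bilinear (\<lambda>(A::'a::{real_normed_field,euclidean_space}^'n^'m) (x::'a^'n). A *v x)"
  unfolding bilinear_conv_bounded_bilinear[symmetric] bilinear_def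
  by (auto intro!: linearI simp: matrix_vector_mult_def vec_eq_iff algebra_simps sum.distrib
      scaleR_sum_right sum_distrib_left)

lemma bounded_bilinear_matrix_matrix:
  "bounded_bilinear (\<lambda>(A::'a::{real_normed_field,euclidean_space}^'n^'m) (B::'a^'l^'n). A ** B)"
  unfolding bilinear_conv_bounded_bilinear[symmetric] bilinear_def
  by (auto intro!: linearI simp: matrix_matrix_mult_def vec_eq_iff algebra_simps sum.distrib
      scaleR_sum_right sum_distrib_left)

lemma norm_entry_le: "norm (A $ i $ j) \<le> norm (A :: 'a::real_normed_vector^'n^'m)"
  by (rule order_trans[OF Finite_Cartesian_Product.norm_nth_le Finite_Cartesian_Product.norm_nth_le])

lemma norm_le_sum_entries:
  "norm (A :: 'a::real_normed_vector^'n^'m) \<le> (\<Sum>i\<in>UNIV. \<Sum>j\<in>UNIV. norm (A $ i $ j))"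
proof -
  have "norm A \<le> (\<Sum>i\<in>UNIV. norm (A $ i))"
    unfolding norm_vec_def[of A] by (rule L2_set_le_sum) simp
  also have "\<dots> \<le> (\<Sum>i\<in>UNIV. \<Sum>j\<in>UNIV. norm (A $ i $ j))"
    by (rule sum_mono) (unfold norm_vec_def, rule L2_set_le_sum, simp)
  finally show ?thesis .
qed

lemma mat_norm_ge: "norm (A *v x) \<le> mat_norm (A :: 'a::{real_normed_field,euclidean_space}^'n^'m) * norm x"
  unfolding mat_norm_def
  by (rule onorm) (rule bounded_bilinear.bounded_linear_right[OF bounded_bilinear_matrix_vector])

lemma mat_norm_nonneg: "0 \<le> mat_norm (A :: 'a::{real_normed_field,euclidean_space}^'n^'m)"
  unfolding mat_norm_def
  by (rule onorm_pos_le) (rule bounded_bilinear.bounded_linear_right[OF bounded_bilinear_matrix_vector])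

lemma mat_norm_triangle:
  "mat_norm (A + B) \<le> mat_norm A + mat_norm (B :: 'a::{real_normed_field,euclidean_space}^'n^'m)"
  unfolding mat_norm_def matrix_vector_mult_add_rdistrib
  by (rule onorm_triangle)
    (rule bounded_bilinear.bounded_linear_right[OF bounded_bilinear_matrix_vector])+

text \<open>The induced norm dominates every entry, because entry \<open>(i, j)\<close> is a component of the image of
  the \<open>j\<close>-th basis vector.  Together with \<open>mat_norm_le_norm\<close> this allows integrals of \<open>mat_norm\<close>
  to be replaced by Bochner integrals and their \<open>L\<^sup>1\<close> norms.\<close>

lemma norm_le_mat_norm:
  "norm (A :: 'a::{real_normed_field,euclidean_space}^'n^'m)
    \<le> real (CARD('m) * CARD('n)) * mat_norm A"
proof -
  have entry: "norm (A $ i $ j) \<le> mat_norm A" for i j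
  proof -
    have "norm (A $ i $ j) = norm ((A *v axis j 1) $ i)"
      by (simp add: matrix_vector_mult_def axis_def if_distrib cong: if_cong)
    also have "\<dots> \<le> norm (A *v axis j 1)" by (rule Finite_Cartesian_Product.norm_nth_le)
    also have "\<dots> \<le> mat_norm A * norm (axis j (1::'a) :: 'a^'n)" by (rule mat_norm_ge)
    also have "norm (axis j (1::'a) :: 'a^'n) = 1"
      by (simp add: norm_vec_def L2_set_def axis_def if_distrib[of norm] if_distribR if_distrib[of "\<lambda>u::real. u ^ 2"] cong: if_cong)
    finally show ?thesis by simp
  qed
  have "norm A \<le> (\<Sum>i\<in>(UNIV::'m set). \<Sum>j\<in>(UNIV::'n set). norm (A $ i $ j))"
    by (rule norm_le_sum_entries)
  also have "\<dots> \<le> (\<Sum>i\<in>(UNIV::'m set). \<Sum>j\<in>(UNIV::'n set). mat_norm A)"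
    by (intro sum_mono entry)
  finally show ?thesis by simp
qed

lemma mat_norm_le_norm:
  obtains c where "0 < c"
    "\<And>A :: 'a::{real_normed_field,euclidean_space}^'n^'m. mat_norm A \<le> c * norm A"
proof -
  obtain c where c: "0 < c" "\<And>(A::'a^'n^'m) x. norm (A *v x) \<le> norm A * norm x * c"
    using bounded_bilinear.pos_bounded[OF bounded_bilinear_matrix_vector] by blast
  show ?thesis
  proof (rule that[OF c(1)])
    fix A :: "'a^'n^'m"
    show "mat_norm A \<le> c * norm A"
      unfolding mat_norm_def
      by (rule onorm_bound) (use c in \<open>auto simp: ac_simps\<close>)
  qed
qed

lemma borel_measurable_mat_norm [measurable]:
  "(mat_norm :: 'a::{real_normed_field,euclidean_space}^'n^'m \<Rightarrow> real) \<in> borel_measurable borel"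
proof -
  obtain c where c: "0 < c" "\<And>A :: 'a^'n^'m. mat_norm A \<le> c * norm A"
    using mat_norm_le_norm by blast
  have le: "mat_norm A - mat_norm B \<le> c * norm (A - B)" for A B :: "'a^'n^'m"
    using mat_norm_triangle[of "A - B" B] c(2)[of "A - B"] by simp
  have "c-lipschitz_on UNIV (mat_norm :: 'a^'n^'m \<Rightarrow> real)"
  proof (rule lipschitz_onI)
    fix A B :: "'a^'n^'m"
    show "dist (mat_norm A) (mat_norm B) \<le> c * dist A B"
      using le[of A B] le[of B A] by (simp add: dist_norm norm_minus_commute)
  qed (use c in simp)
  then show ?thesis
    by (intro borel_measurable_continuous_onI lipschitz_on_continuous_on)
qed

lemma norm_cscale: "norm (cscale z V) = cmod z * norm V"
proof -
  have row: "norm (\<chi> j. z * V $ i $ j) = cmod z * norm (V $ i)" for i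
    unfolding norm_vec_def by (simp add: norm_mult L2_set_right_distrib)
  have "cscale z V = (\<chi> i j. z * V $ i $ j)"
    by (simp add: cscale_def map_matrix_def)
  then have "norm (cscale z V) = L2_set (\<lambda>i. norm (\<chi> j. z * V $ i $ j)) UNIV"
    by (simp add: norm_vec_def[of "\<chi> i j. z * V $ i $ j"])
  then show ?thesis
    by (simp add: row L2_set_right_distrib norm_vec_def[of V])
qed

lemma cscale_nth [simp]: "cscale z V $ i $ j = z * V $ i $ j"
  by (simp add: cscale_def map_matrix_def)

lemma bounded_linear_cscale: "bounded_linear (cscale z :: complex^'n^'m \<Rightarrow> complex^'n^'m)"
  by (rule bounded_linear_intro[where K = "cmod z"])
    (auto simp: vec_eq_iff algebra_simps norm_cscale)

lemma cscale_add: "cscale z (V + W) = cscale z V + cscale z W"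
  and cscale_cscale: "cscale z (cscale y V) = cscale (z * y) V"
  and cscale_one: "cscale 1 V = V"
  by (simp_all add: vec_eq_iff algebra_simps)

section \<open>Quadratic forms and the matrix inequality\<close>

text \<open>The vectors on which the block matrices \<open>hcat\<close>, \<open>vcat\<close> and \<open>sym_block\<close> act.\<close>

definition vjoin :: "'a^'r::finite \<Rightarrow> 'a^'s::finite \<Rightarrow> 'a^('r + 's)" where
  "vjoin x y = (\<chi> k. case k of Inl i \<Rightarrow> x $ i | Inr j \<Rightarrow> y $ j)"

lemma sum_UNIV_Plus:
  fixes f :: "'r::finite + 's::finite \<Rightarrow> 'b::comm_monoid_add"
  shows "(\<Sum>k\<in>UNIV. f k) = (\<Sum>i\<in>UNIV. f (Inl i)) + (\<Sum>j\<in>UNIV. f (Inr j))"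
  unfolding UNIV_Plus_UNIV[symmetric] by (subst sum.Plus) auto

lemma sum_UNIV_prod:
  fixes f :: "'r::finite \<times> 's::finite \<Rightarrow> 'b::comm_monoid_add"
  shows "(\<Sum>k\<in>UNIV. f k) = (\<Sum>i\<in>UNIV. \<Sum>j\<in>UNIV. f (i, j))"
  unfolding UNIV_Times_UNIV[symmetric] sum.cartesian_product by (simp add: case_prod_beta')

lemma inner_vjoin: "vjoin x y \<bullet> vjoin u v = x \<bullet> u + y \<bullet> (v :: real^'s)"
  by (simp add: inner_vec_def vjoin_def sum_UNIV_Plus)

lemma hcat_mult_vjoin: "hcat A B *v vjoin x y = A *v x + B *v (y :: real^'s)"
  by (simp add: vec_eq_iff matrix_vector_mult_def hcat_def vjoin_def sum_UNIV_Plus)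

lemma vcat_mult: "vcat A B *v z = vjoin (A *v z) (B *v (z :: real^'s))"
  by (auto simp: vec_eq_iff matrix_vector_mult_def vcat_def vjoin_def split: sum.splits)

lemma inner_transpose_mult: "x \<bullet> (transpose A *v y) = (A *v x) \<bullet> (y :: real^'m)"
  by (metis dot_lmul_matrix inner_commute transpose_matrix_vector)

lemma sym_block_quadratic:
  "vjoin x y \<bullet> (sym_block P Q S *v vjoin x y)
    = x \<bullet> (P *v x) + 2 * (x \<bullet> (Q *v y)) + y \<bullet> (S *v y)"
  unfolding sym_block_def vcat_mult hcat_mult_vjoin inner_vjoin inner_add_right inner_transpose_mult
  by (simp add: inner_commute)

lemma lmi_matrix_quadratic:
  "vjoin x (vjoin y (vjoin s (vjoin p q)))
      \<bullet> (lmi_matrix R U Fb GA GB kap lam RR *v vjoin x (vjoin y (vjoin s (vjoin p q))))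
    = 2 * (x \<bullet> (U *v x)) - x \<bullet> (R *v x)
      + 2 * ((GA *v (U *v x) + GB *v (Fb *v x)) \<bullet> s)
      + 2 * kap * ((U *v x) \<bullet> p + (Fb *v x) \<bullet> q)
      + lam * (y \<bullet> y) + 2 * lam * (y \<bullet> s) + s \<bullet> (RR *v s) + lam * (p \<bullet> p + q \<bullet> q)"
proof -
  have U2: "x \<bullet> ((U + transpose U - R) *v x) = 2 * (x \<bullet> (U *v x)) - x \<bullet> (R *v x)"
    by (simp add: matrix_vector_mult_diff_rdistrib matrix_vector_mult_add_rdistrib inner_diff_right inner_add_right
        inner_transpose_mult inner_commute del: transpose_matrix_vector)
  show ?thesis
    unfolding lmi_matrix_def sym_block_quadratic hcat_mult_vjoin U2
    by (simp add: scaleR_matrix_vector_assoc[symmetric] matrix_vector_mult_add_rdistrib matrix_vector_mul_assoc[symmetric]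
        inner_transpose_mult inner_add_right inner_add_left hcat_mult_vjoin inner_vjoin
        algebra_simps del: transpose_matrix_vector)
qed

text \<open>The constant is the minimum of the form on the compact unit sphere.  It turns the strict matrix
  inequality into a quantitative one.\<close>

lemma quadratic_form_lower_bound:
  fixes M :: "real^'n^'n"
  assumes pos: "\<And>x. x \<noteq> 0 \<Longrightarrow> 0 < x \<bullet> (M *v x)"
  obtains e where "0 < e" "\<And>x. e * (x \<bullet> x) \<le> x \<bullet> (M *v x)"
proof -
  have "continuous_on (sphere 0 1) (\<lambda>x. x \<bullet> (M *v x))"
    by (intro continuous_intros linear_continuous_on matrix_vector_mul_bounded_linear)
  moreover have "sphere 0 1 \<noteq> ({} :: (real^'n) set)" by simp
  ultimately obtain a where a: "a \<in> sphere 0 1"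
    and min: "\<And>x. x \<in> sphere 0 1 \<Longrightarrow> a \<bullet> (M *v a) \<le> x \<bullet> (M *v x)"
    using continuous_attains_inf[OF compact_sphere] by blast
  show ?thesis
  proof (rule that)
    show "0 < a \<bullet> (M *v a)" using a by (intro pos) auto
    fix x :: "real^'n"
    show "(a \<bullet> (M *v a)) * (x \<bullet> x) \<le> x \<bullet> (M *v x)"
    proof (cases "x = 0")
      case False
      define u where "u = (1 / norm x) *\<^sub>R x"
      have x: "x = norm x *\<^sub>R u" and u: "u \<in> sphere 0 1" using False by (simp_all add: u_def)
      have "x \<bullet> (M *v x) = (norm x) ^ 2 * (u \<bullet> (M *v u))"
        by (subst (1 2) x) (simp add: linear_cmul[OF matrix_vector_mul_linear] power2_eq_square)
      then show ?thesis
        using mult_left_mono[OF min[OF u], of "(norm x) ^ 2"]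
        by (simp add: power2_norm_eq_inner mult.commute)
    qed simp
  qed
qed

lemma quadratic_form_upper_bound:
  fixes M :: "real^'n^'n"
  obtains c where "0 < c" "\<And>x. x \<bullet> (M *v x) \<le> c * (x \<bullet> x)"
proof -
  obtain a where a: "0 < a" "\<And>(M :: real^'n^'n) x. norm (M *v x) \<le> norm M * norm x * a"
    using bounded_bilinear.pos_bounded[OF bounded_bilinear_matrix_vector] by blast
  show ?thesis
  proof (rule that[of "norm M * a + 1"])
    show "0 < norm M * a + 1" using a by (simp add: add_nonneg_pos)
    fix x
    have "x \<bullet> (M *v x) \<le> norm x * norm (M *v x)" by (rule norm_cauchy_schwarz)
    also have "\<dots> \<le> norm x * (norm M * norm x * a)" by (intro mult_left_mono a) simp
    also have "\<dots> \<le> (norm M * a + 1) * (x \<bullet> x)"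
      by (simp add: power2_norm_eq_inner[symmetric] power2_eq_square algebra_simps)
    finally show "x \<bullet> (M *v x) \<le> (norm M * a + 1) * (x \<bullet> x)" .
  qed
qed

lemma invertible_if_inj:
  fixes M :: "real^'n^'n"
  assumes "\<And>x. M *v x = 0 \<Longrightarrow> x = 0"
  shows "M *v (matrix_inv M *v y) = y" "matrix_inv M *v (M *v y) = y"
proof -
  have "invertible M"
    using assms by (simp add: invertible_left_inverse matrix_left_invertible_ker)
  then have "M ** matrix_inv M = mat 1 \<and> matrix_inv M ** M = mat 1"
    unfolding invertible_def matrix_inv_def by (rule someI_ex)
  then show "M *v (matrix_inv M *v y) = y" "matrix_inv M *v (M *v y) = y"
    by (simp_all add: matrix_vector_mul_assoc)
qed

text \<open>The last claim is the Fenchel inequality between the forms of \<open>R\<close> and of its inverse, obtained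
  by completing the square: the difference of the two sides is \<open>d \<bullet> (R *v d)\<close> with
  \<open>d = x - matrix_inv R *v y\<close>.\<close>

lemma pos_def_inverse:
  assumes R: "pos_def R"
  shows "R *v (matrix_inv R *v y) = y"
    and "x \<noteq> 0 \<Longrightarrow> 0 < x \<bullet> (matrix_inv R *v x)"
    and "2 * (x \<bullet> y) - x \<bullet> (R *v x) \<le> y \<bullet> (matrix_inv R *v y)"
proof -
  have pos: "0 < x \<bullet> (R *v x)" if "x \<noteq> 0" for x using R that by (simp add: pos_def_def)
  have sym: "transpose R = R" using R by (simp add: pos_def_def)
  have "x = 0" if "R *v x = 0" for x using pos[of x] that by auto
  note inv = invertible_if_inj[OF this]
  show R_inv: "R *v (matrix_inv R *v y) = y" for y
    by (rule inv(1); assumption)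
  show "0 < x \<bullet> (matrix_inv R *v x)" if x: "x \<noteq> 0" for x
  proof -
    have "matrix_inv R *v x \<noteq> 0" using R_inv[of x] x by auto
    from pos[OF this] show ?thesis by (simp add: R_inv inner_commute)
  qed
  define d where "d = x - matrix_inv R *v y"
  have "0 \<le> d \<bullet> (R *v d)" using pos[of d] by (cases "d = 0") auto
  also have "d \<bullet> (R *v d) = x \<bullet> (R *v x) - 2 * (x \<bullet> y) + y \<bullet> (matrix_inv R *v y)"
    using inner_transpose_mult[of "matrix_inv R *v y" R x]
    by (simp add: d_def matrix_vector_mult_diff_distrib R_inv inner_diff_left inner_diff_right
        sym inner_commute algebra_simps del: transpose_matrix_vector)
  finally show "2 * (x \<bullet> y) - x \<bullet> (R *v x) \<le> y \<bullet> (matrix_inv R *v y)" by simp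
qed

text \<open>Let \<open>h = U x\<close>, \<open>f = Fb x\<close> and \<open>RR s = v\<close>.  The test vector has blocks \<open>x\<close>, \<open>s\<close>, \<open>- s\<close> and
  \<open>- (kap / lam) (h, f)\<close>; its second and fourth blocks minimise the quadratic form for the given
  \<open>x\<close> and third block \<open>- s\<close>.  What the minimisation leaves behind,
  \<open>- kap\<^sup>2 / lam * |(h, f)|\<^sup>2 - lam * |s|\<^sup>2\<close>, is by Young's inequality exactly what is needed to
  replace the nominal vector \<open>GA h + GB f\<close> by any \<open>v\<close> at distance at most \<open>kap * |(h, f)|\<close>.
  The form is then at most
  \<open>2 * (x \<bullet> h) - x \<bullet> R x - v \<bullet> s\<close>, and the Fenchel inequality bounds the first two terms by
  \<open>h \<bullet> matrix_inv R h\<close>.\<close>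

lemma lmi_contraction:
  fixes R U :: "real^'n^'n" and Fb :: "real^'n^'m"
    and GA :: "real^'n^('k::finite \<times> 'n)" and GB :: "real^'m^('k \<times> 'n)"
  assumes LMI: "pos_def (lmi_matrix R U Fb GA GB kap lam RR)"
    and R: "pos_def R" and lam: "0 < lam" and kap: "0 \<le> kap"
  obtains a where "0 \<le> a" "a < 1"
    "\<And>h v s. RR *v s = v \<Longrightarrow>
      norm (v - hcat GA GB *v vjoin h ((Fb ** matrix_inv U) *v h))
        \<le> kap * norm (vjoin h ((Fb ** matrix_inv U) *v h)) \<Longrightarrow>
      v \<bullet> s \<le> a * (h \<bullet> (matrix_inv R *v h))"
proof -
  let ?M = "lmi_matrix R U Fb GA GB kap lam RR"
  let ?P = "matrix_inv R"
  obtain e where e: "0 < e" "\<And>z. e * (z \<bullet> z) \<le> z \<bullet> (?M *v z)"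
    using quadratic_form_lower_bound[of ?M] LMI unfolding pos_def_def by blast
  have U_inj: "x = 0" if "U *v x = 0" for x
  proof (rule ccontr)
    assume x: "x \<noteq> 0"
    have "0 < e * (x \<bullet> x)" using e(1) x by simp
    also have "\<dots> \<le> - (x \<bullet> (R *v x))"
      using e(2)[of "vjoin x (vjoin 0 (vjoin 0 (vjoin (0::real^'n) (0::real^'m))))"] that
      unfolding lmi_matrix_quadratic by (simp add: inner_vjoin)
    also have "\<dots> < 0" using R x by (simp add: pos_def_def)
    finally show False .
  qed
  note U_inv = invertible_if_inj[OF U_inj]
  obtain C where C: "0 < C" "\<And>x. x \<bullet> ((transpose U ** ?P ** U) *v x) \<le> C * (x \<bullet> x)"
    using quadratic_form_upper_bound[of "transpose U ** ?P ** U"] by blast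
  (* The margin e * |x|^2 is at least e / C times the form of matrix_inv R at h = U x.  The maximum
     with 0 keeps the factor nonnegative when e exceeds C. *)
  define a where "a = max 0 (1 - e / C)"
  show ?thesis
  proof (rule that[of a])
    show "0 \<le> a" "a < 1" using e(1) C(1) by (auto simp: a_def)
    fix h :: "real^'n" and v s :: "real^('k \<times> 'n)"
    define x where "x = matrix_inv U *v h"
    define f where "f = Fb *v x"
    have h: "U *v x = h" by (simp add: x_def U_inv)
    have f: "(Fb ** matrix_inv U) *v h = f" by (simp add: f_def x_def matrix_vector_mul_assoc)
    assume s: "RR *v s = v"
      and close: "norm (v - hcat GA GB *v vjoin h ((Fb ** matrix_inv U) *v h))
        \<le> kap * norm (vjoin h ((Fb ** matrix_inv U) *v h))"
    define d where "d = v - hcat GA GB *v vjoin h f"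
    have G: "GA *v h + GB *v f = v - d" by (simp add: d_def hcat_mult_vjoin)
    have "norm d ^ 2 \<le> (kap * norm (vjoin h f)) ^ 2"
      using close unfolding f d_def by (intro power_mono) auto
    then have dd: "d \<bullet> d \<le> kap ^ 2 * (h \<bullet> h + f \<bullet> f)"
      by (simp add: power_mult_distrib power2_norm_eq_inner inner_vjoin)
    have "0 \<le> (d - lam *\<^sub>R s) \<bullet> (d - lam *\<^sub>R s)" by simp
    also have "\<dots> = d \<bullet> d - 2 * lam * (d \<bullet> s) + lam ^ 2 * (s \<bullet> s)"
      by (simp add: inner_diff_left inner_diff_right inner_commute power2_eq_square algebra_simps)
    finally have "2 * (d \<bullet> s) * lam \<le> kap ^ 2 * (h \<bullet> h + f \<bullet> f) + lam * (s \<bullet> s) * lam"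
      using dd by (simp add: power2_eq_square algebra_simps)
    then have "2 * (d \<bullet> s) * lam \<le> (kap ^ 2 / lam * (h \<bullet> h + f \<bullet> f) + lam * (s \<bullet> s)) * lam"
      using lam by (simp add: distrib_right)
    then have young: "2 * (d \<bullet> s) \<le> kap ^ 2 / lam * (h \<bullet> h + f \<bullet> f) + lam * (s \<bullet> s)"
      using lam by (rule mult_right_le_imp_le)
    let ?t = "- (kap / lam)"
    let ?z = "vjoin x (vjoin s (vjoin (- s) (vjoin (?t *\<^sub>R h) (?t *\<^sub>R f))))"
    have "e * (x \<bullet> x) \<le> e * (?z \<bullet> ?z)"
      using e(1) by (intro mult_left_mono)
        (simp_all add: inner_vjoin del: inner_scaleR_left inner_scaleR_right)
    also have "\<dots> \<le> ?z \<bullet> (?M *v ?z)" by (rule e(2))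
    also have "\<dots> = 2 * (x \<bullet> h) - x \<bullet> (R *v x) - 2 * ((v - d) \<bullet> s)
        - kap ^ 2 / lam * (h \<bullet> h + f \<bullet> f) - lam * (s \<bullet> s) + v \<bullet> s"
    proof -
      have neg: "RR *v (- s) = - v" using linear_neg[OF matrix_vector_mul_linear, of RR s] s by simp
      have pp: "lam * ((?t *\<^sub>R h) \<bullet> (?t *\<^sub>R h) + (?t *\<^sub>R f) \<bullet> (?t *\<^sub>R f)) = kap ^ 2 / lam * (h \<bullet> h + f \<bullet> f)"
        using lam by (simp add: power2_eq_square field_simps)
      have hp: "2 * kap * (h \<bullet> (?t *\<^sub>R h) + f \<bullet> (?t *\<^sub>R f)) = - 2 * (kap ^ 2 / lam * (h \<bullet> h + f \<bullet> f))"
        by (simp add: power2_eq_square algebra_simps)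
      show ?thesis
        unfolding lmi_matrix_quadratic h f_def[symmetric] G neg pp hp
        by (simp add: inner_commute)
    qed
    also have "\<dots> \<le> h \<bullet> (?P *v h) - v \<bullet> s"
      using young pos_def_inverse(3)[OF R, of x h] by (simp add: inner_diff_left)
    finally have main: "e * (x \<bullet> x) \<le> h \<bullet> (?P *v h) - v \<bullet> s" .
    have "h \<bullet> (?P *v h) \<le> C * (x \<bullet> x)"
      using C(2)[of x] by (simp add: matrix_vector_mul_assoc[symmetric] inner_transpose_mult h
          del: transpose_matrix_vector)
    then have "e / C * (h \<bullet> (?P *v h)) \<le> e / C * (C * (x \<bullet> x))"
      using e(1) C(1) by (intro mult_left_mono) auto
    also have "\<dots> = e * (x \<bullet> x)" using C(1) by simp
    finally have "v \<bullet> s \<le> (1 - e / C) * (h \<bullet> (?P *v h))"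
      using main by (simp add: left_diff_distrib)
    also have "\<dots> \<le> a * (h \<bullet> (?P *v h))"
    proof (rule mult_right_mono)
      show "0 \<le> h \<bullet> (?P *v h)"
        using pos_def_inverse(2)[OF R, of h] by (cases "h = 0") auto
    qed (simp add: a_def)
    finally show "v \<bullet> s \<le> a * (h \<bullet> (?P *v h))" .
  qed
qed

lemma weighted_stack_mult:
  "weighted_stack v A *v h = (\<chi> r. sqrt (v (fst r)) * (A *v h) $ snd r)"
  by (simp add: weighted_stack_def matrix_vector_mult_def vec_eq_iff sum_distrib_left mult.assoc)

lemma block_diag_mult:
  "block_diag R *v (\<chi> r. c (fst r) * (x (fst r) :: real^'n) $ snd r)
    = (\<chi> r. c (fst r) * (R (fst r) *v x (fst r)) $ snd r)"
proof -
  have "(\<Sum>l\<in>UNIV. \<Sum>j\<in>UNIV. (if i = l then R i $ k $ j else 0) * (c l * x l $ j))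
      = c i * (\<Sum>j\<in>UNIV. R i $ k $ j * x i $ j)" for i k
  proof -
    have "(\<Sum>l\<in>UNIV. \<Sum>j\<in>UNIV. (if i = l then R i $ k $ j else 0) * (c l * x l $ j))
        = (\<Sum>l\<in>UNIV. if i = l then (\<Sum>j\<in>UNIV. R i $ k $ j * (c l * x l $ j)) else 0)"
      by (intro sum.cong refl) auto
    then show ?thesis by (simp add: sum_distrib_left ac_simps)
  qed
  from this show ?thesis
    by (simp only: vec_eq_iff matrix_vector_mult_def block_diag_def sum_UNIV_prod vec_lambda_beta
        fst_conv snd_conv split_paired_All) simp
qed

lemma inner_stack:
  "(\<chi> r. c (fst r) * (x (fst r) :: real^'n) $ snd r) \<bullet> (\<chi> r. d (fst r) * (y (fst r) :: real^'n) $ snd r)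
    = (\<Sum>j\<in>(UNIV::'k::finite set). c j * d j * (x j \<bullet> y j))"
  by (simp add: inner_vec_def sum_UNIV_prod sum_distrib_left ac_simps)

text \<open>The case where \<open>v\<close> is the closed-loop image of \<open>h\<close>, stacked with the weights \<open>sqrt (w j)\<close>: then
  \<open>s\<close> can be computed block by block, and the square roots multiply to the weights \<open>w j\<close>.  The
  factor \<open>a\<close> is uniform in \<open>A\<close>, \<open>B\<close> and \<open>w\<close>, hence uniform over the states in a box.\<close>

lemma closed_loop_contraction:
  fixes R :: "'k::finite \<Rightarrow> real^'n^'n" and U :: "real^'n^'n" and Fb :: "real^'n^'m"
    and GA :: "real^'n^('k \<times> 'n)" and GB :: "real^'m^('k \<times> 'n)"
  assumes LMI: "pos_def (lmi_matrix (R i) U Fb GA GB kap lam (block_diag R))"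
    and R: "\<And>j. pos_def (R j)" and lam: "0 < lam" and kap: "0 \<le> kap"
  obtains a where "0 \<le> a" "a < 1"
    "\<And>A B w h. (\<And>j. 0 \<le> w j) \<Longrightarrow>
      mat_norm (hcat (weighted_stack w A) (weighted_stack w B) - hcat GA GB) \<le> kap \<Longrightarrow>
      (\<Sum>j\<in>UNIV. w j * (((A + B ** (Fb ** matrix_inv U)) *v h)
          \<bullet> (matrix_inv (R j) *v ((A + B ** (Fb ** matrix_inv U)) *v h))))
        \<le> a * (h \<bullet> (matrix_inv (R i) *v h))"
proof -
  obtain a where a: "0 \<le> a" "a < 1"
    "\<And>h v s. block_diag R *v s = v \<Longrightarrow>
      norm (v - hcat GA GB *v vjoin h ((Fb ** matrix_inv U) *v h))
        \<le> kap * norm (vjoin h ((Fb ** matrix_inv U) *v h)) \<Longrightarrow>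
      v \<bullet> s \<le> a * (h \<bullet> (matrix_inv (R i) *v h))"
    using lmi_contraction[OF LMI R lam kap] by blast
  show ?thesis
  proof (rule that[OF a(1,2)])
    fix A :: "real^'n^'n" and B :: "real^'m^'n" and w :: "'k \<Rightarrow> real" and h :: "real^'n"
    assume w: "\<And>j. 0 \<le> w j"
      and close: "mat_norm (hcat (weighted_stack w A) (weighted_stack w B) - hcat GA GB) \<le> kap"
    define F where "F = Fb ** matrix_inv U"
    define y where "y = (A + B ** F) *v h"
    define v :: "real^('k \<times> 'n)" where "v = (\<chi> r. sqrt (w (fst r)) * y $ snd r)"
    define s :: "real^('k \<times> 'n)"
      where "s = (\<chi> r. sqrt (w (fst r)) * (matrix_inv (R (fst r)) *v y) $ snd r)"
    have "block_diag R *v s = v"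
      unfolding s_def v_def
      using block_diag_mult[of R "\<lambda>j. sqrt (w j)" "\<lambda>j. matrix_inv (R j) *v y"]
      by (simp add: pos_def_inverse(1)[OF R])
    moreover have "norm (v - hcat GA GB *v vjoin h (F *v h)) \<le> kap * norm (vjoin h (F *v h))"
    proof -
      have v: "v = hcat (weighted_stack w A) (weighted_stack w B) *v vjoin h (F *v h)"
        by (simp add: v_def y_def hcat_mult_vjoin weighted_stack_mult vec_eq_iff
            matrix_vector_mult_add_rdistrib matrix_vector_mul_assoc[symmetric] distrib_left)
      have "v - hcat GA GB *v vjoin h (F *v h)
          = (hcat (weighted_stack w A) (weighted_stack w B) - hcat GA GB) *v vjoin h (F *v h)"
        unfolding v by (simp add: matrix_vector_mult_diff_rdistrib)
      then show ?thesis
        using order_trans[OF mat_norm_ge mult_right_mono[OF close]] by simp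
    qed
    ultimately have "v \<bullet> s \<le> a * (h \<bullet> (matrix_inv (R i) *v h))"
      unfolding F_def by (rule a(3))
    moreover have "v \<bullet> s = (\<Sum>j\<in>UNIV. w j * (y \<bullet> (matrix_inv (R j) *v y)))"
      unfolding v_def s_def
      using inner_stack[of "\<lambda>j. sqrt (w j)" "\<lambda>_. y" "\<lambda>j. sqrt (w j)" "\<lambda>j. matrix_inv (R j) *v y"]
      by (simp add: w)
    ultimately show "(\<Sum>j\<in>UNIV. w j * (((A + B ** (Fb ** matrix_inv U)) *v h)
          \<bullet> (matrix_inv (R j) *v ((A + B ** (Fb ** matrix_inv U)) *v h))))
        \<le> a * (h \<bullet> (matrix_inv (R i) *v h))"
      by (simp add: y_def F_def)
  qed
qed

section \<open>Neumann series for operators on integrable matrix functions\<close>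

text \<open>The sum of the \<open>L\<^sup>1\<close> norms is finite, so by monotone convergence the pointwise sum of the norms is
  finite almost everywhere.\<close>

lemma geometric_series_L1:
  fixes f :: "nat \<Rightarrow> 'a \<Rightarrow> 'b::{banach,second_countable_topology}"
  assumes f: "\<And>k. integrable M (f k)"
    and bound: "\<And>k. (\<integral>x. norm (f k x) \<partial>M) \<le> a * q ^ k"
    and q: "0 \<le> q" "q < 1"
  shows "AE x in M. summable (\<lambda>k. norm (f k x))"
    and "integrable M (\<lambda>x. \<Sum>k. f k x)"
    and "(\<integral>x. norm (\<Sum>k. f k x) \<partial>M) \<le> a / (1 - q)"
proof -
  have [measurable]: "f k \<in> borel_measurable M" for k
    by (rule borel_measurable_integrable[OF f])
  have geom: "(\<lambda>k. a * q ^ k) sums (a / (1 - q))"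
    using sums_mult[OF geometric_sums[of q], of a] q by simp
  have summ: "summable (\<lambda>k. \<integral>x. norm (f k x) \<partial>M)"
    by (rule summable_comparison_test'[OF sums_summable[OF geom], of 0]) (simp add: bound)
  have "(\<integral>\<^sup>+x. (\<Sum>k. ennreal (norm (f k x))) \<partial>M) = (\<Sum>k. \<integral>\<^sup>+x. ennreal (norm (f k x)) \<partial>M)"
    by (intro nn_integral_suminf) measurable
  also have "\<dots> = (\<Sum>k. ennreal (\<integral>x. norm (f k x) \<partial>M))"
    by (intro suminf_cong nn_integral_eq_integral integrable_norm f) simp
  also have "\<dots> \<noteq> \<infinity>"
    unfolding infinity_ennreal_def by (rule ennreal_suminf_neq_top[OF summ]) simp
  finally have "AE x in M. (\<Sum>k. ennreal (norm (f k x))) \<noteq> \<infinity>"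
    by (intro nn_integral_PInf_AE) simp_all
  then show ae: "AE x in M. summable (\<lambda>k. norm (f k x))"
    by eventually_elim (rule summable_suminf_not_top; simp)
  show "integrable M (\<lambda>x. \<Sum>k. f k x)"
    by (rule integrable_suminf[OF f ae summ])
  have ae': "AE x in M. summable (\<lambda>k. norm (norm (f k x)))" using ae by simp
  have summ': "summable (\<lambda>k. \<integral>x. norm (norm (f k x)) \<partial>M)" using summ by simp
  have "(\<integral>x. norm (\<Sum>k. f k x) \<partial>M) \<le> (\<integral>x. (\<Sum>k. norm (f k x)) \<partial>M)"
  proof (rule integral_mono_AE)
    show "integrable M (\<lambda>x. norm (\<Sum>k. f k x))"
      by (intro integrable_norm integrable_suminf[OF f ae summ])
    show "integrable M (\<lambda>x. \<Sum>k. norm (f k x))"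
      by (rule integrable_suminf[OF integrable_norm[OF f] ae' summ'])
    show "AE x in M. norm (\<Sum>k. f k x) \<le> (\<Sum>k. norm (f k x))"
      using ae by eventually_elim (rule summable_norm)
  qed
  also have "\<dots> = (\<Sum>k. \<integral>x. norm (f k x) \<partial>M)"
    by (rule integral_suminf[OF integrable_norm[OF f] ae' summ'])
  also have "\<dots> \<le> (\<Sum>k. a * q ^ k)"
    by (rule suminf_le[OF bound summ sums_summable[OF geom]])
  also have "\<dots> = a / (1 - q)" using geom by (rule sums_unique[symmetric])
  finally show "(\<integral>x. norm (\<Sum>k. f k x) \<partial>M) \<le> a / (1 - q)" .
qed

lemma H1C_norm_le_L1:
  obtains c where "0 < c"
    "\<And>V :: 'a \<Rightarrow> complex^'n^'n. V \<in> H1C \<mu> \<Longrightarrow> H1C_norm \<mu> V \<le> c * (\<integral>x. norm (V x) \<partial>\<mu>)"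
proof -
  obtain c where c: "0 < c" "\<And>A :: complex^'n^'n. mat_norm A \<le> c * norm A"
    using mat_norm_le_norm by blast
  show ?thesis
  proof (rule that[OF c(1)])
    fix V :: "'a \<Rightarrow> complex^'n^'n" assume "V \<in> H1C \<mu>"
    then have V: "integrable \<mu> (\<lambda>x. c * norm (V x))" by (simp add: H1C_def)
    show "H1C_norm \<mu> V \<le> c * (\<integral>x. norm (V x) \<partial>\<mu>)"
      using integral_mono'[OF V c(2)] c(1) by (simp add: H1C_norm_def)
  qed
qed

lemma L1_le_H1C_norm:
  fixes V :: "'a \<Rightarrow> complex^'n^'n"
  assumes "V \<in> H1C \<mu>"
  shows "(\<integral>x. norm (V x) \<partial>\<mu>) \<le> real (CARD('n) * CARD('n)) * H1C_norm \<mu> V"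
proof -
  obtain c where c: "0 < c" "\<And>A :: complex^'n^'n. mat_norm A \<le> c * norm A"
    using mat_norm_le_norm by blast
  have V: "integrable \<mu> V" using assms by (simp add: H1C_def)
  have "integrable \<mu> (\<lambda>x. mat_norm (V x))"
  proof (rule Bochner_Integration.integrable_bound[where f = "\<lambda>x. c * norm (V x)"])
    show "AE x in \<mu>. norm (mat_norm (V x)) \<le> norm (c * norm (V x))"
      using c by (auto simp: mat_norm_nonneg)
    show "integrable \<mu> (\<lambda>x. c * norm (V x))" using V by simp
    show "(\<lambda>x. mat_norm (V x)) \<in> borel_measurable \<mu>"
      by (rule measurable_compose[OF borel_measurable_integrable[OF V] borel_measurable_mat_norm])
  qed
  then have "integrable \<mu> (\<lambda>x. real (CARD('n) * CARD('n)) * mat_norm (V x))" by simp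
  from integral_mono'[OF this norm_le_mat_norm] show ?thesis
    by (simp add: H1C_norm_def mat_norm_nonneg del: of_nat_mult)
qed

lemma H1C_closed:
  assumes "V \<in> H1C \<mu>"
  shows "(\<lambda>x. cscale z (V x)) \<in> H1C \<mu>"
    and "W \<in> H1C \<mu> \<Longrightarrow> (\<lambda>x. V x + W x) \<in> H1C \<mu>"
    and "W \<in> H1C \<mu> \<Longrightarrow> (\<lambda>x. V x - W x) \<in> H1C \<mu>"
  using assms integrable_bounded_linear[OF bounded_linear_cscale, of \<mu> V z]
  by (auto simp: H1C_def)

lemma H1C_sum: "(\<And>k. k \<in> I \<Longrightarrow> f k \<in> H1C \<mu>) \<Longrightarrow> (\<lambda>x. \<Sum>k\<in>I. f k x) \<in> H1C \<mu>"
  by (simp add: H1C_def)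

lemma L1_eq_0_AE:
  "integrable M f \<Longrightarrow> (\<integral>x. norm (f x :: 'b::{banach,second_countable_topology}) \<partial>M) \<le> 0 \<Longrightarrow> AE x in M. f x = 0"
  using integral_nonneg_eq_0_iff_AE[of M "\<lambda>x. norm (f x)"]
  by (simp add: antisym[OF _ Bochner_Integration.integral_nonneg])

lemma H1C_bounded_linearD:
  assumes "H1C_bounded_linear \<mu> T" "V \<in> H1C \<mu>"
  shows "T V \<in> H1C \<mu>"
    and "W \<in> H1C \<mu> \<Longrightarrow> AE x in \<mu>. T (\<lambda>y. V y + W y) x = T V x + T W x"
    and "AE x in \<mu>. T (\<lambda>y. cscale z (V y)) x = cscale z (T V x)"
  using assms unfolding H1C_bounded_linear_def by blast+

lemma H1C_bounded_linear_L1: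
  fixes T :: "('a \<Rightarrow> complex^'n^'n) \<Rightarrow> ('a \<Rightarrow> complex^'n^'n)"
  assumes T: "H1C_bounded_linear \<mu> T"
  obtains C where "0 \<le> C"
    "\<And>V. V \<in> H1C \<mu> \<Longrightarrow> (\<integral>x. norm (T V x) \<partial>\<mu>) \<le> C * (\<integral>x. norm (V x) \<partial>\<mu>)"
proof -
  obtain C where C: "\<And>V. V \<in> H1C \<mu> \<Longrightarrow> H1C_norm \<mu> (T V) \<le> C * H1C_norm \<mu> V"
    using T unfolding H1C_bounded_linear_def by blast
  obtain c where c: "0 < c"
    "\<And>V :: 'a \<Rightarrow> complex^'n^'n. V \<in> H1C \<mu> \<Longrightarrow> H1C_norm \<mu> V \<le> c * (\<integral>x. norm (V x) \<partial>\<mu>)"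
    using H1C_norm_le_L1 by blast
  define d where "d = real (CARD('n) * CARD('n))"
  have d: "0 \<le> d" by (simp add: d_def)
  show ?thesis
  proof (rule that[of "d * (\<bar>C\<bar> * c)"])
    show "0 \<le> d * (\<bar>C\<bar> * c)" using c d by simp
    fix V :: "'a \<Rightarrow> complex^'n^'n" assume V: "V \<in> H1C \<mu>"
    have nn: "0 \<le> H1C_norm \<mu> V" by (simp add: H1C_norm_def mat_norm_nonneg)
    have "(\<integral>x. norm (T V x) \<partial>\<mu>) \<le> d * H1C_norm \<mu> (T V)"
      unfolding d_def by (rule L1_le_H1C_norm[OF H1C_bounded_linearD(1)[OF T V]])
    also have "\<dots> \<le> d * (C * H1C_norm \<mu> V)"
      by (rule mult_left_mono[OF C[OF V] d])
    also have "\<dots> \<le> d * (\<bar>C\<bar> * H1C_norm \<mu> V)"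
      by (intro mult_left_mono mult_right_mono d nn) simp
    also have "\<dots> \<le> d * (\<bar>C\<bar> * (c * (\<integral>x. norm (V x) \<partial>\<mu>)))"
      by (intro mult_left_mono c V d) simp
    finally show "(\<integral>x. norm (T V x) \<partial>\<mu>) \<le> d * (\<bar>C\<bar> * c) * (\<integral>x. norm (V x) \<partial>\<mu>)"
      by (simp add: ac_simps)
  qed
qed

lemma H1C_bounded_linearI:
  fixes T :: "('a \<Rightarrow> complex^'n^'n) \<Rightarrow> ('a \<Rightarrow> complex^'n^'n)"
  assumes closed: "\<And>V. V \<in> H1C \<mu> \<Longrightarrow> T V \<in> H1C \<mu>"
    and add: "\<And>V W. V \<in> H1C \<mu> \<Longrightarrow> W \<in> H1C \<mu> \<Longrightarrow>
      AE x in \<mu>. T (\<lambda>y. V y + W y) x = T V x + T W x"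
    and scale: "\<And>z V. V \<in> H1C \<mu> \<Longrightarrow> AE x in \<mu>. T (\<lambda>y. cscale z (V y)) x = cscale z (T V x)"
    and C: "0 \<le> C"
      "\<And>V. V \<in> H1C \<mu> \<Longrightarrow> (\<integral>x. norm (T V x) \<partial>\<mu>) \<le> C * (\<integral>x. norm (V x) \<partial>\<mu>)"
  shows "H1C_bounded_linear \<mu> T"
proof -
  obtain c where c: "0 < c"
    "\<And>V :: 'a \<Rightarrow> complex^'n^'n. V \<in> H1C \<mu> \<Longrightarrow> H1C_norm \<mu> V \<le> c * (\<integral>x. norm (V x) \<partial>\<mu>)"
    using H1C_norm_le_L1 by blast
  have "H1C_norm \<mu> (T V) \<le> (c * C * real (CARD('n) * CARD('n))) * H1C_norm \<mu> V"
    if V: "V \<in> H1C \<mu>" for V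
  proof -
    have "H1C_norm \<mu> (T V) \<le> c * (\<integral>x. norm (T V x) \<partial>\<mu>)" by (rule c closed V)+
    also have "\<dots> \<le> c * (C * (\<integral>x. norm (V x) \<partial>\<mu>))"
      using c C(2)[OF V] by simp
    also have "\<dots> \<le> c * (C * (real (CARD('n) * CARD('n)) * H1C_norm \<mu> V))"
      by (intro mult_left_mono L1_le_H1C_norm V) (use c C in auto)
    finally show ?thesis by (simp add: ac_simps)
  qed
  then show ?thesis unfolding H1C_bounded_linear_def using closed add scale by blast
qed

text \<open>The elements of \<open>H1C\<close> are functions, so this compatibility with equality almost everywhere has
  to be derived; it follows from the norm bound applied to the difference.\<close>

lemma H1C_bounded_linear_cong:
  fixes T :: "('a \<Rightarrow> complex^'n^'n) \<Rightarrow> ('a \<Rightarrow> complex^'n^'n)"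
  assumes T: "H1C_bounded_linear \<mu> T" and V: "V \<in> H1C \<mu>" and W: "W \<in> H1C \<mu>"
    and eq: "AE x in \<mu>. V x = W x"
  shows "AE x in \<mu>. T V x = T W x"
proof -
  obtain C where C: "0 \<le> C"
    "\<And>V. V \<in> H1C \<mu> \<Longrightarrow> (\<integral>x. norm (T V x) \<partial>\<mu>) \<le> C * (\<integral>x. norm (V x) \<partial>\<mu>)"
    using H1C_bounded_linear_L1[OF T] by blast
  define D where "D = (\<lambda>x. V x - W x)"
  have D: "D \<in> H1C \<mu>" unfolding D_def by (rule H1C_closed(3)[OF V W])
  have "(\<integral>x. norm (D x) \<partial>\<mu>) = 0"
    by (rule integral_eq_zero_AE) (use eq in \<open>auto simp: D_def\<close>)
  then have "(\<integral>x. norm (T D x) \<partial>\<mu>) \<le> 0" using C(2)[OF D] by simp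
  then have "AE x in \<mu>. T D x = 0"
    using H1C_bounded_linearD(1)[OF T D] by (intro L1_eq_0_AE) (auto simp: H1C_def)
  moreover have "AE x in \<mu>. T (\<lambda>y. W y + D y) x = T W x + T D x"
    by (rule H1C_bounded_linearD(2)[OF T W D])
  moreover have "(\<lambda>y. W y + D y) = V" by (simp add: D_def)
  ultimately show ?thesis by auto
qed

lemma H1C_bounded_linear_diff:
  assumes T: "H1C_bounded_linear \<mu> T" and V: "V \<in> H1C \<mu>" and W: "W \<in> H1C \<mu>"
  shows "AE x in \<mu>. T (\<lambda>y. V y - W y) x = T V x - T W x"
  using H1C_bounded_linearD(2)[OF T H1C_closed(3)[OF V W] W] by auto

lemma H1C_bounded_linear_sum:
  fixes T :: "('a \<Rightarrow> complex^'n^'n) \<Rightarrow> ('a \<Rightarrow> complex^'n^'n)" and m :: nat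
  assumes T: "H1C_bounded_linear \<mu> T" and f: "\<And>k. f k \<in> H1C \<mu>"
  shows "AE x in \<mu>. T (\<lambda>y. \<Sum>k<m. f k y) x = (\<Sum>k<m. T (f k) x)"
proof (induction m)
  case 0
  have "(\<lambda>_. 0) \<in> H1C \<mu>" by (simp add: H1C_def)
  from H1C_bounded_linearD(2)[OF T this this] show ?case by simp
next
  case (Suc m)
  have "AE x in \<mu>. T (\<lambda>y. (\<Sum>k<m. f k y) + f m y) x = T (\<lambda>y. \<Sum>k<m. f k y) x + T (f m) x"
    by (intro H1C_bounded_linearD(2)[OF T] H1C_sum f)
  with Suc show ?case by auto
qed

lemma H1C_bounded_linear_funpow:
  fixes T :: "('a \<Rightarrow> complex^'n^'n) \<Rightarrow> ('a \<Rightarrow> complex^'n^'n)"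
  assumes T: "H1C_bounded_linear \<mu> T"
  shows "H1C_bounded_linear \<mu> (T ^^ k)"
proof (induction k)
  case 0
  show ?case by (rule H1C_bounded_linearI[of _ _ 1]) auto
next
  case (Suc k)
  let ?P = "T ^^ k"
  obtain C where C: "0 \<le> C"
    "\<And>V. V \<in> H1C \<mu> \<Longrightarrow> (\<integral>x. norm (T V x) \<partial>\<mu>) \<le> C * (\<integral>x. norm (V x) \<partial>\<mu>)"
    using H1C_bounded_linear_L1[OF T] by blast
  obtain D where D: "0 \<le> D"
    "\<And>V. V \<in> H1C \<mu> \<Longrightarrow> (\<integral>x. norm (?P V x) \<partial>\<mu>) \<le> D * (\<integral>x. norm (V x) \<partial>\<mu>)"
    using H1C_bounded_linear_L1[OF Suc] by blast
  note TD = H1C_bounded_linearD[OF T] and PD = H1C_bounded_linearD[OF Suc]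
  show ?case
  proof (rule H1C_bounded_linearI[of _ _ "C * D"])
    fix V W :: "'a \<Rightarrow> complex^'n^'n" and z assume V: "V \<in> H1C \<mu>"
    then show "(T ^^ Suc k) V \<in> H1C \<mu>" by (simp add: TD PD)
    have "(\<integral>x. norm ((T ^^ Suc k) V x) \<partial>\<mu>) \<le> C * (\<integral>x. norm (?P V x) \<partial>\<mu>)"
      by (simp add: C PD V)
    also have "\<dots> \<le> C * (D * (\<integral>x. norm (V x) \<partial>\<mu>))"
      by (intro mult_left_mono C D V)
    finally show "(\<integral>x. norm ((T ^^ Suc k) V x) \<partial>\<mu>) \<le> C * D * (\<integral>x. norm (V x) \<partial>\<mu>)"
      by (simp add: ac_simps)
    have "AE x in \<mu>. T (?P (\<lambda>y. cscale z (V y))) x = T (\<lambda>y. cscale z (?P V y)) x"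
      by (intro H1C_bounded_linear_cong[OF T] PD H1C_closed V)
    moreover have "AE x in \<mu>. T (\<lambda>y. cscale z (?P V y)) x = cscale z (T (?P V) x)"
      by (intro TD PD V)
    ultimately show "AE x in \<mu>. (T ^^ Suc k) (\<lambda>y. cscale z (V y)) x = cscale z ((T ^^ Suc k) V x)"
      by auto
    assume W: "W \<in> H1C \<mu>"
    have "AE x in \<mu>. T (?P (\<lambda>y. V y + W y)) x = T (\<lambda>y. ?P V y + ?P W y) x"
      by (intro H1C_bounded_linear_cong[OF T] PD H1C_closed V W)
    moreover have "AE x in \<mu>. T (\<lambda>y. ?P V y + ?P W y) x = T (?P V) x + T (?P W) x"
      by (intro TD PD V W)
    ultimately show "AE x in \<mu>. (T ^^ Suc k) (\<lambda>y. V y + W y) x = (T ^^ Suc k) V x + (T ^^ Suc k) W x"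
      by auto
  qed (use C D in simp)
qed

text \<open>The inverse is the Neumann series \<open>S V = (\<Sum>k. (T ^^ k) V / z ^ (k + 1))\<close>, summed pointwise: the
  power bound makes its terms decay like \<open>(r / cmod z) ^ k\<close> in \<open>L\<^sup>1\<close>.  Shifting the index gives
  \<open>z * S V = V + S (T V)\<close>, so both inverse laws follow once \<open>T\<close> and \<open>S\<close> are known to commute.
  They commute because they do so on partial sums and \<open>T\<close> is bounded on the tails.\<close>

lemma H1C_resolvent_of_power_bound:
  fixes T :: "('a \<Rightarrow> complex^'n^'n) \<Rightarrow> ('a \<Rightarrow> complex^'n^'n)"
  assumes T: "H1C_bounded_linear \<mu> T" and r: "0 \<le> r" and C: "0 \<le> C"
    and power: "\<And>k V. V \<in> H1C \<mu> \<Longrightarrow>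
      (\<integral>x. norm ((T ^^ k) V x) \<partial>\<mu>) \<le> C * r ^ k * (\<integral>x. norm (V x) \<partial>\<mu>)"
    and z: "r < cmod z"
  shows "z \<in> H1C_resolvent_set \<mu> T"
proof -
  define q where "q = r / cmod z"
  have q: "0 \<le> q" "q < 1" and z0: "z \<noteq> 0" using r z by (auto simp: q_def divide_less_eq)
  define N where "N = (\<lambda>V :: 'a \<Rightarrow> complex^'n^'n. \<integral>x. norm (V x) \<partial>\<mu>)"
  define t where "t = (\<lambda>k V x. cscale (inverse (z ^ Suc k)) ((T ^^ k) V x))"
  define S where "S = (\<lambda>V x. \<Sum>k. t k V x)"
  define K where "K = C / cmod z"
  have K: "0 \<le> K" using C by (simp add: K_def)
  note TkD = H1C_bounded_linearD[OF H1C_bounded_linear_funpow[OF T]]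
  note TD = H1C_bounded_linearD[OF T]
  have t_H1C: "t k V \<in> H1C \<mu>" if "V \<in> H1C \<mu>" for k V
    unfolding t_def by (intro H1C_closed TkD that)
  have t_int: "integrable \<mu> (t k V)" if "V \<in> H1C \<mu>" for k V
    using t_H1C[OF that] by (simp add: H1C_def)
  have t_bound: "(\<integral>x. norm (t k V x) \<partial>\<mu>) \<le> K * N V * q ^ k" if V: "V \<in> H1C \<mu>" for k V
  proof -
    have "(\<integral>x. norm (t k V x) \<partial>\<mu>) = inverse (cmod z ^ Suc k) * (\<integral>x. norm ((T ^^ k) V x) \<partial>\<mu>)"
      by (simp add: t_def norm_cscale norm_inverse norm_power norm_mult)
    also have "\<dots> \<le> inverse (cmod z ^ Suc k) * (C * r ^ k * N V)"
      unfolding N_def by (intro mult_left_mono power V) simp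
    also have "\<dots> = K * N V * q ^ k"
      by (simp add: K_def q_def field_simps power_divide)
    finally show ?thesis .
  qed
  have tail_bound: "(\<integral>x. norm (t (k + m) V x) \<partial>\<mu>) \<le> (K * N V * q ^ m) * q ^ k"
    if "V \<in> H1C \<mu>" for k m V
    using t_bound[OF that, of "k + m"] by (simp add: power_add ac_simps)
  have summ: "AE x in \<mu>. summable (\<lambda>k. t k V x)" if "V \<in> H1C \<mu>" for V
    using geometric_series_L1(1)[OF t_int[OF that] t_bound[OF that] q]
    by eventually_elim (rule summable_norm_cancel)
  have S_H1C: "S V \<in> H1C \<mu>" if "V \<in> H1C \<mu>" for V
    using geometric_series_L1(2)[OF t_int[OF that] t_bound[OF that] q]
    by (simp add: S_def H1C_def)
  have S_bound: "N (S V) \<le> K / (1 - q) * N V" if "V \<in> H1C \<mu>" for V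
    using geometric_series_L1(3)[OF t_int[OF that] t_bound[OF that] q]
    by (simp add: S_def N_def)
  (* E m V is the tail of the series after m terms; its norm tends to 0 geometrically. *)
  define E where "E = (\<lambda>m V x. S V x - (\<Sum>k<m. t k V x))"
  have E_H1C: "E m V \<in> H1C \<mu>" if "V \<in> H1C \<mu>" for m V
    unfolding E_def by (intro H1C_closed H1C_sum S_H1C t_H1C that)
  have E_bound: "N (E m V) \<le> K / (1 - q) * N V * q ^ m" if V: "V \<in> H1C \<mu>" for m V
  proof -
    have "N (E m V) = (\<integral>x. norm (\<Sum>k. t (k + m) V x) \<partial>\<mu>)"
      unfolding N_def
    proof (rule integral_cong_AE)
      show "AE x in \<mu>. norm (E m V x) = norm (\<Sum>k. t (k + m) V x)"
        using summ[OF V] by eventually_elim (simp add: E_def S_def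
          suminf_minus_initial_segment[of "\<lambda>k. t k V x" m for x])
      show "(\<lambda>x. norm (E m V x)) \<in> borel_measurable \<mu>"
        using E_H1C[OF V, of m] by (auto simp: H1C_def)
      show "(\<lambda>x. norm (\<Sum>k. t (k + m) V x)) \<in> borel_measurable \<mu>"
        by (intro borel_measurable_integrable integrable_norm)
          (rule geometric_series_L1(2)[OF t_int[OF V] tail_bound[OF V] q])
    qed
    also have "\<dots> \<le> K * N V * q ^ m / (1 - q)"
      by (rule geometric_series_L1(3)[OF t_int[OF V] tail_bound[OF V] q])
    finally show ?thesis by simp
  qed
  have S_lin: "H1C_bounded_linear \<mu> S"
  proof (rule H1C_bounded_linearI[of _ _ "K / (1 - q)"])
    fix V W :: "'a \<Rightarrow> complex^'n^'n" and y assume V: "V \<in> H1C \<mu>"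
    show "S V \<in> H1C \<mu>" by (rule S_H1C[OF V])
    show "(\<integral>x. norm (S V x) \<partial>\<mu>) \<le> K / (1 - q) * (\<integral>x. norm (V x) \<partial>\<mu>)"
      using S_bound[OF V] by (simp add: N_def)
    have "AE x in \<mu>. \<forall>k. (T ^^ k) (\<lambda>u. cscale y (V u)) x = cscale y ((T ^^ k) V x)"
      by (intro AE_all_countable[THEN iffD2] allI TkD V)
    then have "AE x in \<mu>. \<forall>k. t k (\<lambda>u. cscale y (V u)) x = cscale y (t k V x)"
      by eventually_elim (simp add: t_def cscale_cscale ac_simps)
    with summ[OF V] show "AE x in \<mu>. S (\<lambda>u. cscale y (V u)) x = cscale y (S V x)"
      by eventually_elim (simp add: S_def bounded_linear.suminf[OF bounded_linear_cscale])
    assume W: "W \<in> H1C \<mu>"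
    have "AE x in \<mu>. \<forall>k. (T ^^ k) (\<lambda>u. V u + W u) x = (T ^^ k) V x + (T ^^ k) W x"
      by (intro AE_all_countable[THEN iffD2] allI TkD V W)
    then have "AE x in \<mu>. \<forall>k. t k (\<lambda>u. V u + W u) x = t k V x + t k W x"
      by eventually_elim (simp add: t_def cscale_add)
    with summ[OF V] summ[OF W] show "AE x in \<mu>. S (\<lambda>u. V u + W u) x = S V x + S W x"
      by eventually_elim (simp add: S_def suminf_add)
  qed (use K q in simp)
  note SD = H1C_bounded_linearD[OF S_lin]
  have shift: "AE x in \<mu>. cscale z (S V x) = V x + S (T V) x" if V: "V \<in> H1C \<mu>" for V
    using summ[OF V]
  proof eventually_elim
    fix x assume *: "summable (\<lambda>k. t k V x)"
    have Suc: "cscale z (t (Suc k) V x) = t k (T V) x" for k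
      using z0 by (simp add: t_def cscale_cscale funpow_swap1 mult.assoc[symmetric])
    have "S V x = t 0 V x + (\<Sum>k. t (Suc k) V x)"
      unfolding S_def using suminf_split_head[OF *] by simp
    moreover have "cscale z (\<Sum>k. t (Suc k) V x) = S (T V) x"
      unfolding S_def Suc[symmetric]
      by (rule bounded_linear.suminf[OF bounded_linear_cscale])
        (use * summable_Suc_iff[of "\<lambda>k. t k V x"] in simp)
    moreover have "cscale z (t 0 V x) = V x"
      using z0 by (simp add: t_def cscale_cscale cscale_one)
    ultimately show "cscale z (S V x) = V x + S (T V) x"
      by (simp add: cscale_add)
  qed
  have commute: "AE x in \<mu>. T (S V) x = S (T V) x" if V: "V \<in> H1C \<mu>" for V
  proof -
    obtain Ct where Ct: "0 \<le> Ct" "\<And>V. V \<in> H1C \<mu> \<Longrightarrow> N (T V) \<le> Ct * N V"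
      unfolding N_def using H1C_bounded_linear_L1[OF T] by blast
    define D where "D = (\<lambda>x. T (S V) x - S (T V) x)"
    have D: "D \<in> H1C \<mu>" unfolding D_def by (intro H1C_closed S_H1C TD V)
    have D_bound: "N D \<le> (Ct * (K / (1 - q) * N V) + K / (1 - q) * N (T V)) * q ^ m" for m
    proof -
      have "AE x in \<mu>. T (t k V) x = t k (T V) x" for k
        using TD(3)[OF TkD(1)[OF V, of k], of "inverse (z ^ Suc k)"]
        by (simp add: t_def funpow_swap1)
      then have "AE x in \<mu>. \<forall>k. T (t k V) x = t k (T V) x"
        by (intro AE_all_countable[THEN iffD2] allI)
      moreover have "AE x in \<mu>. T (\<lambda>y. \<Sum>k<m. t k V y) x = (\<Sum>k<m. T (t k V) x)"
        by (intro H1C_bounded_linear_sum[OF T] t_H1C V)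
      moreover have "AE x in \<mu>. T (E m V) x = T (S V) x - T (\<lambda>y. \<Sum>k<m. t k V y) x"
        unfolding E_def by (intro H1C_bounded_linear_diff[OF T] S_H1C H1C_sum t_H1C V)
      (* The partial sums of T (S V) and of S (T V) agree, so only tails remain. *)
      ultimately have eq: "AE x in \<mu>. D x = T (E m V) x - E m (T V) x"
        by eventually_elim (simp add: D_def E_def)
      have i: "integrable \<mu> (T (E m V))" "integrable \<mu> (E m (T V))"
        using TD(1)[OF E_H1C[OF V, of m]] E_H1C[OF TD(1)[OF V], of m] by (simp_all add: H1C_def)
      have "N D \<le> (\<integral>x. norm (T (E m V) x) + norm (E m (T V) x) \<partial>\<mu>)"
        unfolding N_def
      proof (rule integral_mono_AE)
        show "integrable \<mu> (\<lambda>x. norm (D x))" using D by (simp add: H1C_def)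
        show "AE x in \<mu>. norm (D x) \<le> norm (T (E m V) x) + norm (E m (T V) x)"
          using eq by eventually_elim (simp add: norm_triangle_ineq4)
      qed (use i in simp)
      also have "\<dots> = N (T (E m V)) + N (E m (T V))"
        unfolding N_def using i by simp
      also have "\<dots> \<le> Ct * (K / (1 - q) * N V * q ^ m) + K / (1 - q) * N (T V) * q ^ m"
        by (intro add_mono order_trans[OF Ct(2)] mult_left_mono E_bound E_H1C TD V Ct)
      finally show ?thesis by (simp add: algebra_simps)
    qed
    have "(\<lambda>m. (Ct * (K / (1 - q) * N V) + K / (1 - q) * N (T V)) * q ^ m) \<longlonglongrightarrow>
        (Ct * (K / (1 - q) * N V) + K / (1 - q) * N (T V)) * 0"
      by (intro tendsto_intros LIMSEQ_power_zero) (use q in simp)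
    then have "N D \<le> 0"
      by (intro LIMSEQ_le_const[of _ _ "N D"]) (use D_bound in auto)
    then have "AE x in \<mu>. D x = 0"
      using D by (intro L1_eq_0_AE) (auto simp: H1C_def N_def)
    then show ?thesis by (simp add: D_def)
  qed
  have "AE x in \<mu>. S (\<lambda>y. cscale z (V y) - T V y) x = V x" if V: "V \<in> H1C \<mu>" for V
  proof -
    have "AE x in \<mu>. S (\<lambda>y. cscale z (V y) - T V y) x = S (\<lambda>y. cscale z (V y)) x - S (T V) x"
      by (intro H1C_bounded_linear_diff[OF S_lin] H1C_closed TD V)
    moreover have "AE x in \<mu>. S (\<lambda>y. cscale z (V y)) x = cscale z (S V x)"
      by (intro SD V)
    ultimately show ?thesis using shift[OF V] by eventually_elim simp
  qed
  moreover have "AE x in \<mu>. cscale z (S V x) - T (S V) x = V x" if V: "V \<in> H1C \<mu>" for V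
    using shift[OF V] commute[OF V] by eventually_elim simp
  ultimately show ?thesis
    unfolding H1C_resolvent_set_def using S_lin by blast
qed

lemma H1C_spectral_radius_le:
  fixes T :: "('a \<Rightarrow> complex^'n^'n) \<Rightarrow> ('a \<Rightarrow> complex^'n^'n)"
  assumes T: "H1C_bounded_linear \<mu> T" and r: "0 \<le> r" and C: "0 \<le> C"
    and power: "\<And>k V. V \<in> H1C \<mu> \<Longrightarrow>
      (\<integral>x. norm ((T ^^ k) V x) \<partial>\<mu>) \<le> C * r ^ k * (\<integral>x. norm (V x) \<partial>\<mu>)"
  shows "H1C_spectral_radius \<mu> T \<le> ennreal r"
  unfolding H1C_spectral_radius_def
proof (rule SUP_least)
  fix z assume "z \<in> H1C_spectrum \<mu> T"
  then have "cmod z \<le> r"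
    using H1C_resolvent_of_power_bound[OF T r C power, of z]
    unfolding H1C_spectrum_def by (meson ComplD not_le)
  then show "ennreal (cmod z) \<le> ennreal r" by (rule ennreal_leI)
qed

section \<open>The second-moment operator and its adjoint\<close>

definition conj_by :: "real^'n^'n \<Rightarrow> complex^'n^'n \<Rightarrow> complex^'n^'n" where
  "conj_by K V = map_matrix complex_of_real K ** V ** transpose (map_matrix complex_of_real K)"

lemma map_matrix_of_real_mult:
  "map_matrix complex_of_real (A ** B) = map_matrix complex_of_real A ** map_matrix complex_of_real B"
  by (simp add: map_matrix_def matrix_matrix_mult_def vec_eq_iff)

lemma map_matrix_of_real_transpose:
  "map_matrix complex_of_real (transpose A) = transpose (map_matrix complex_of_real A)"
  by (simp add: map_matrix_def transpose_def vec_eq_iff)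

lemma norm_map_matrix_of_real: "norm (map_matrix complex_of_real A) = norm A"
  by (simp add: map_matrix_def norm_vec_def)

lemma bounded_linear_map_matrix_of_real:
  "bounded_linear (map_matrix complex_of_real :: real^'n^'m \<Rightarrow> complex^'n^'m)"
  by (rule bounded_linear_intro[where K = 1])
    (simp_all add: norm_map_matrix_of_real, simp_all add: map_matrix_def vec_eq_iff scaleR_conv_of_real[where 'a = complex])

lemma bounded_linear_transpose:
  "bounded_linear (transpose :: 'a::euclidean_space^'n^'m \<Rightarrow> 'a^'m^'n)"
  by (auto intro!: linear_conv_bounded_linear[THEN iffD1] linearI simp: transpose_def vec_eq_iff)

lemma conj_by_bound:
  obtains c where "0 < c"
    "\<And>K (V :: complex^'n^'n). norm (conj_by K V) \<le> c * norm K ^ 2 * norm V"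
proof -
  obtain a where a: "0 < a"
    "\<And>(A::complex^'n^'n) (B::complex^'n^'n). norm (A ** B) \<le> norm A * norm B * a"
    using bounded_bilinear.pos_bounded[OF bounded_bilinear_matrix_matrix] by blast
  obtain t where t: "0 < t" "\<And>A :: complex^'n^'n. norm (transpose A) \<le> norm A * t"
    using bounded_linear.pos_bounded[OF bounded_linear_transpose] by blast
  show ?thesis
  proof (rule that[of "a * a * t"])
    show "0 < a * a * t" using a t by simp
    fix K :: "real^'n^'n" and V :: "complex^'n^'n"
    let ?K = "map_matrix complex_of_real K"
    have "norm (conj_by K V) \<le> norm (?K ** V) * norm (transpose ?K) * a"
      unfolding conj_by_def by (rule a)
    also have "\<dots> \<le> (norm ?K * norm V * a) * (norm ?K * t) * a"
      by (intro mult_right_mono mult_mono a t) (use a in auto)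
    finally show "norm (conj_by K V) \<le> a * a * t * norm K ^ 2 * norm V"
      by (simp add: norm_map_matrix_of_real power2_eq_square ac_simps)
  qed
qed

lemma bounded_linear_conj_by: "bounded_linear (conj_by K :: complex^'n^'n \<Rightarrow> _)"
  unfolding conj_by_def
  by (intro bounded_linear_compose[OF bounded_bilinear.bounded_linear_left[OF bounded_bilinear_matrix_matrix]]
      bounded_bilinear.bounded_linear_right[OF bounded_bilinear_matrix_matrix])

lemma conj_by_cscale: "conj_by K (cscale z V) = cscale z (conj_by K V)"
  by (simp add: conj_by_def vec_eq_iff matrix_matrix_mult_def sum_distrib_left sum_distrib_right ac_simps)

lemma borel_measurable_matrix_mult [measurable (raw)]:
  fixes f :: "'a \<Rightarrow> 'b::{real_normed_field,euclidean_space}^'n^'m" and h :: "'a \<Rightarrow> 'b^'l^'n"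
  assumes [measurable]: "f \<in> borel_measurable M" "h \<in> borel_measurable M"
  shows "(\<lambda>x. f x ** h x) \<in> borel_measurable M"
  by (rule borel_measurable_continuous_Pair[OF assms])
    (intro bounded_bilinear.continuous_on[OF bounded_bilinear_matrix_matrix] continuous_intros)

lemma borel_measurable_bounded_linear:
  "bounded_linear T \<Longrightarrow> f \<in> borel_measurable M \<Longrightarrow> (\<lambda>x. T (f x)) \<in> borel_measurable M"
  by (rule measurable_compose[OF _ borel_measurable_continuous_onI])
    (auto intro: linear_continuous_on)

lemma borel_measurable_conj_by [measurable (raw)]:
  fixes V :: "'a \<Rightarrow> complex^'n^'n"
  assumes "K \<in> borel_measurable M" "V \<in> borel_measurable M"
  shows "(\<lambda>x. conj_by (K x) (V x)) \<in> borel_measurable M"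
  unfolding conj_by_def
  by (intro borel_measurable_matrix_mult assms
      borel_measurable_bounded_linear[OF bounded_linear_map_matrix_of_real]
      borel_measurable_bounded_linear[OF bounded_linear_transpose])

text \<open>The bilinear trace form, without complex conjugation, so that integrals and the operator can be
  moved across it by linearity alone.\<close>

definition pairing :: "real^'n^'n \<Rightarrow> complex^'n^'n \<Rightarrow> complex" where
  "pairing Q M = trace (transpose (map_matrix complex_of_real Q) ** M)"

lemma pairing_eq_sum: "pairing Q M = (\<Sum>j\<in>UNIV. \<Sum>i\<in>UNIV. Q $ i $ j *\<^sub>R M $ i $ j)"
  by (simp add: pairing_def trace_def matrix_matrix_mult_def transpose_def map_matrix_def scaleR_conv_of_real)

lemma bounded_bilinear_pairing: "bounded_bilinear pairing"
  unfolding bilinear_conv_bounded_bilinear[symmetric] bilinear_def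
  by (auto intro!: linearI simp: pairing_eq_sum algebra_simps sum.distrib scaleR_sum_right)

lemma borel_measurable_pairing:
  assumes "Q \<in> borel_measurable M" "V \<in> borel_measurable M"
  shows "(\<lambda>x. pairing (Q x) (V x)) \<in> borel_measurable M"
  by (rule borel_measurable_continuous_Pair[OF assms])
    (intro bounded_bilinear.continuous_on[OF bounded_bilinear_pairing] continuous_intros)

text \<open>Cyclicity of the trace moves the congruence from one side to the other.\<close>

lemma pairing_conj_by: "pairing Q (conj_by K M) = pairing (transpose K ** Q ** K) M"
proof -
  let ?c = "map_matrix complex_of_real"
  have "pairing Q (conj_by K M) = trace ((transpose (?c Q) ** ?c K ** M) ** transpose (?c K))"
    by (simp add: pairing_def conj_by_def matrix_mul_assoc)
  also have "\<dots> = trace (transpose (?c K) ** (transpose (?c Q) ** ?c K ** M))"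
    by (rule trace_mul_sym)
  also have "\<dots> = pairing (transpose K ** Q ** K) M"
    by (simp add: pairing_def map_matrix_of_real_mult map_matrix_of_real_transpose
        matrix_transpose_mul matrix_mul_assoc)
  finally show ?thesis .
qed

text \<open>A Markov chain with transition density \<open>g\<close> whose state selects an essentially bounded matrix
  coefficient \<open>K\<close>; in the application \<open>K\<close> is the closed loop.\<close>

locale weighted_chain = sigma_finite_measure \<mu> for \<mu> :: "'a measure" +
  fixes g :: "'a \<Rightarrow> 'a \<Rightarrow> real" and K :: "'a \<Rightarrow> real^'n^'n" and b :: real
  assumes g: "transition_density \<mu> g"
    and K_measurable [measurable]: "K \<in> borel_measurable \<mu>"
    and K_bounded: "AE x in \<mu>. norm (K x) \<le> b"
begin

sublocale pair: pair_sigma_finite \<mu> \<mu> ..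

lemma g_measurable [measurable]: "case_prod g \<in> borel_measurable (\<mu> \<Otimes>\<^sub>M \<mu>)"
  using g by (simp add: transition_density_def)

lemma g_nonneg: "x \<in> space \<mu> \<Longrightarrow> y \<in> space \<mu> \<Longrightarrow> 0 \<le> g x y"
  using g by (simp add: transition_density_def)

lemma g_section_measurable: "x \<in> space \<mu> \<Longrightarrow> g x \<in> borel_measurable \<mu>"
  using measurable_Pair2[OF g_measurable, of x] by simp

lemma
  assumes x: "x \<in> space \<mu>"
  shows g_integrable: "integrable \<mu> (g x)" and g_integral: "(\<integral>y. g x y \<partial>\<mu>) = 1"
proof -
  have m: "g x \<in> borel_measurable \<mu>" by (rule g_section_measurable[OF x])
  have nn: "AE y in \<mu>. 0 \<le> g x y" using g_nonneg[OF x] by simp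
  have "prob_space (density \<mu> (\<lambda>y. ennreal (g x y)))"
    using g x by (simp add: transition_density_def)
  then have "emeasure (density \<mu> (\<lambda>y. ennreal (g x y))) (space \<mu>) = 1"
    using prob_space.emeasure_space_1 by fastforce
  then have *: "(\<integral>\<^sup>+y. ennreal (g x y) \<partial>\<mu>) = 1"
    using m by (simp add: emeasure_density cong: nn_integral_cong)
  show "integrable \<mu> (g x)"
    by (rule integrableI_nonneg[OF m nn]) (simp add: *)
  show "(\<integral>y. g x y \<partial>\<mu>) = 1"
    using integral_eq_nn_integral[OF m nn] by (simp add: *)
qed

text \<open>Since \<open>g y\<close> has integral 1, integrating first over the next state \<open>x\<close> leaves at most \<open>W y\<close>; so
  Tonelli's theorem gives both claims.\<close>

lemma kernel_integrable:
  fixes f :: "'a \<Rightarrow> 'a \<Rightarrow> 'b::{banach,second_countable_topology}" and W :: "'a \<Rightarrow> real"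
  assumes f [measurable]: "case_prod f \<in> borel_measurable (\<mu> \<Otimes>\<^sub>M \<mu>)"
    and W: "integrable \<mu> W"
    and le: "\<And>y. y \<in> space \<mu> \<Longrightarrow> AE x in \<mu>. norm (f y x) \<le> W y"
  shows "integrable (\<mu> \<Otimes>\<^sub>M \<mu>) (\<lambda>(y, x). g y x *\<^sub>R f y x)"
    and "(\<integral>x. norm (\<integral>y. g y x *\<^sub>R f y x \<partial>\<mu>) \<partial>\<mu>) \<le> (\<integral>y. W y \<partial>\<mu>)"
proof -
  have gf [measurable]: "(\<lambda>(y, x). g y x *\<^sub>R f y x) \<in> borel_measurable (\<mu> \<Otimes>\<^sub>M \<mu>)"
    using g_measurable f by (simp add: case_prod_beta')
  have f_sec: "f y \<in> borel_measurable \<mu>" if "y \<in> space \<mu>" for y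
    using measurable_Pair2[OF f that] by simp
  have dom: "integrable \<mu> (\<lambda>x. W y * g y x)" if "y \<in> space \<mu>" for y
    using g_integrable[OF that] by simp
  have le': "AE x in \<mu>. norm (g y x *\<^sub>R f y x) \<le> W y * g y x" if y: "y \<in> space \<mu>" for y
    using le[OF y] AE_space
    by eventually_elim (use y in \<open>simp add: g_nonneg mult.commute[of "W y"] mult_left_mono\<close>)
  have sec: "integrable \<mu> (\<lambda>x. g y x *\<^sub>R f y x)" if y: "y \<in> space \<mu>" for y
  proof (rule Bochner_Integration.integrable_bound[OF dom[OF y]])
    show "(\<lambda>x. g y x *\<^sub>R f y x) \<in> borel_measurable \<mu>"
      by (intro borel_measurable_scaleR g_section_measurable f_sec y)
    show "AE x in \<mu>. norm (g y x *\<^sub>R f y x) \<le> norm (W y * g y x)"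
      using le'[OF y] by eventually_elim simp
  qed
  have int_le: "(\<integral>x. norm (g y x *\<^sub>R f y x) \<partial>\<mu>) \<le> W y" if y: "y \<in> space \<mu>" for y
  proof -
    have "(\<integral>x. norm (g y x *\<^sub>R f y x) \<partial>\<mu>) \<le> (\<integral>x. W y * g y x \<partial>\<mu>)"
      by (rule integral_mono_AE[OF integrable_norm[OF sec[OF y]] dom[OF y] le'[OF y]])
    then show ?thesis by (simp add: g_integral[OF y])
  qed
  have outer: "integrable \<mu> (\<lambda>y. \<integral>x. norm (g y x *\<^sub>R f y x) \<partial>\<mu>)"
  proof (rule Bochner_Integration.integrable_bound[OF W])
    show "(\<lambda>y. \<integral>x. norm (g y x *\<^sub>R f y x) \<partial>\<mu>) \<in> borel_measurable \<mu>"
      using gf by (intro borel_measurable_lebesgue_integral) (simp add: case_prod_beta')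
    show "AE y in \<mu>. norm (\<integral>x. norm (g y x *\<^sub>R f y x) \<partial>\<mu>) \<le> norm (W y)"
      by (rule AE_I2) (use int_le in \<open>simp add: order_trans[OF _ abs_ge_self]\<close>)
  qed
  show int: "integrable (\<mu> \<Otimes>\<^sub>M \<mu>) (\<lambda>(y, x). g y x *\<^sub>R f y x)"
  proof (rule pair.Fubini_integrable[OF gf])
    show "integrable \<mu> (\<lambda>y. \<integral>x. norm (case (y, x) of (y, x) \<Rightarrow> g y x *\<^sub>R f y x) \<partial>\<mu>)"
      using outer by simp
    show "AE y in \<mu>. integrable \<mu> (\<lambda>x. case (y, x) of (y, x) \<Rightarrow> g y x *\<^sub>R f y x)"
      by (rule AE_I2) (use sec in simp)
  qed
  have int_norm: "integrable (\<mu> \<Otimes>\<^sub>M \<mu>) (\<lambda>(y, x). norm (g y x *\<^sub>R f y x))"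
    using integrable_norm[OF int] by (simp add: case_prod_beta')
  have "(\<integral>x. norm (\<integral>y. g y x *\<^sub>R f y x \<partial>\<mu>) \<partial>\<mu>) \<le> (\<integral>x. \<integral>y. norm (g y x *\<^sub>R f y x) \<partial>\<mu> \<partial>\<mu>)"
    by (intro integral_mono integrable_norm pair.integrable_snd[OF int] pair.integrable_snd[OF int_norm]
        integral_norm_bound)
  also have "\<dots> = (\<integral>y. \<integral>x. norm (g y x *\<^sub>R f y x) \<partial>\<mu> \<partial>\<mu>)"
    by (rule pair.Fubini_integral[OF int_norm])
  also have "\<dots> \<le> (\<integral>y. W y \<partial>\<mu>)"
    by (rule integral_mono[OF outer W int_le])
  finally show "(\<integral>x. norm (\<integral>y. g y x *\<^sub>R f y x \<partial>\<mu>) \<partial>\<mu>) \<le> (\<integral>y. W y \<partial>\<mu>)" .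
qed

lemma L_op_conj_by: "L_op \<mu> g K V x = (\<integral>y. g y x *\<^sub>R conj_by (K y) (V y) \<partial>\<mu>)"
  by (simp add: L_op_def conj_by_def)

lemma conj_by_K_bound:
  obtains c where "0 \<le> c"
    "\<And>V. AE y in \<mu>. norm (conj_by (K y) (V y)) \<le> c * norm (V y)"
proof -
  obtain c where c: "0 < c"
    "\<And>K (V :: complex^'n^'n). norm (conj_by K V) \<le> c * norm K ^ 2 * norm V"
    using conj_by_bound by blast
  show ?thesis
  proof (rule that[of "c * b ^ 2"])
    fix V :: "'a \<Rightarrow> complex^'n^'n"
    show "AE y in \<mu>. norm (conj_by (K y) (V y)) \<le> c * b ^ 2 * norm (V y)"
      using K_bounded
      by eventually_elim
        (rule order_trans[OF c(2)], use c in \<open>auto intro!: mult_mono power_mono\<close>)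
  qed (use c in simp)
qed

lemma conj_by_K_integrable:
  assumes "integrable \<mu> V"
  shows "integrable \<mu> (\<lambda>y. conj_by (K y) (V y))"
proof -
  obtain c where c: "0 \<le> c" "\<And>V. AE y in \<mu>. norm (conj_by (K y) (V y)) \<le> c * norm (V y)"
    using conj_by_K_bound by blast
  show ?thesis
  proof (rule Bochner_Integration.integrable_bound[where f = "\<lambda>y. c * norm (V y)"])
    show "integrable \<mu> (\<lambda>y. c * norm (V y))" using assms by simp
    show "(\<lambda>y. conj_by (K y) (V y)) \<in> borel_measurable \<mu>"
      by (intro borel_measurable_conj_by K_measurable borel_measurable_integrable assms)
    show "AE y in \<mu>. norm (conj_by (K y) (V y)) \<le> norm (c * norm (V y))"
      using c(2)[of V] by eventually_elim (use c(1) in simp)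
  qed
qed

lemma L_op_kernel_integrable:
  assumes V: "integrable \<mu> V"
  shows "integrable (\<mu> \<Otimes>\<^sub>M \<mu>) (\<lambda>(y, x). g y x *\<^sub>R conj_by (K y) (V y))"
    and "(\<integral>x. norm (L_op \<mu> g K V x) \<partial>\<mu>) \<le> (\<integral>y. norm (conj_by (K y) (V y)) \<partial>\<mu>)"
proof -
  have m: "case_prod (\<lambda>y x :: 'a. conj_by (K y) (V y)) \<in> borel_measurable (\<mu> \<Otimes>\<^sub>M \<mu>)"
    using borel_measurable_integrable[OF conj_by_K_integrable[OF V]]
    by (simp add: case_prod_beta')
  note * = kernel_integrable[OF m integrable_norm[OF conj_by_K_integrable[OF V]]]
  show "integrable (\<mu> \<Otimes>\<^sub>M \<mu>) (\<lambda>(y, x). g y x *\<^sub>R conj_by (K y) (V y))"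
    by (rule *) simp
  show "(\<integral>x. norm (L_op \<mu> g K V x) \<partial>\<mu>) \<le> (\<integral>y. norm (conj_by (K y) (V y)) \<partial>\<mu>)"
    unfolding L_op_conj_by by (rule *) simp
qed

lemma L_op_bounded_linear: "H1C_bounded_linear \<mu> (L_op \<mu> g K)"
proof -
  obtain c where c: "0 \<le> c" "\<And>V. AE y in \<mu>. norm (conj_by (K y) (V y)) \<le> c * norm (V y)"
    using conj_by_K_bound by blast
  show ?thesis
  proof (rule H1C_bounded_linearI[OF _ _ _ c(1)])
    fix V W :: "'a \<Rightarrow> complex^'n^'n" and z assume "V \<in> H1C \<mu>"
    then have V: "integrable \<mu> V" by (simp add: H1C_def)
    show "L_op \<mu> g K V \<in> H1C \<mu>"
      unfolding H1C_def L_op_conj_by[abs_def]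
      using pair.integrable_snd[OF L_op_kernel_integrable(1)[OF V]] by simp
    show "AE x in \<mu>. L_op \<mu> g K (\<lambda>y. cscale z (V y)) x = cscale z (L_op \<mu> g K V x)"
      using pair.AE_integrable_snd[OF L_op_kernel_integrable(1)[OF V]]
    proof eventually_elim
      fix x assume i: "integrable \<mu> (\<lambda>y. g y x *\<^sub>R conj_by (K y) (V y))"
      show "L_op \<mu> g K (\<lambda>y. cscale z (V y)) x = cscale z (L_op \<mu> g K V x)"
        unfolding L_op_conj_by conj_by_cscale
          linear_cmul[OF bounded_linear.linear[OF bounded_linear_cscale], symmetric]
        by (rule integral_bounded_linear[OF bounded_linear_cscale i])
    qed
    have "(\<integral>y. norm (conj_by (K y) (V y)) \<partial>\<mu>) \<le> (\<integral>y. c * norm (V y) \<partial>\<mu>)"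
      by (rule integral_mono_AE[OF integrable_norm[OF conj_by_K_integrable[OF V]] _ c(2)])
        (use V in simp)
    with L_op_kernel_integrable(2)[OF V]
    show "(\<integral>x. norm (L_op \<mu> g K V x) \<partial>\<mu>) \<le> c * (\<integral>x. norm (V x) \<partial>\<mu>)"
      by simp
    assume "W \<in> H1C \<mu>"
    then have W: "integrable \<mu> W" by (simp add: H1C_def)
    show "AE x in \<mu>. L_op \<mu> g K (\<lambda>y. V y + W y) x = L_op \<mu> g K V x + L_op \<mu> g K W x"
      using pair.AE_integrable_snd[OF L_op_kernel_integrable(1)[OF V]]
        pair.AE_integrable_snd[OF L_op_kernel_integrable(1)[OF W]]
      by eventually_elim
        (simp add: L_op_conj_by linear_add[OF bounded_linear.linear[OF bounded_linear_conj_by]]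
          scaleR_add_right)
  qed
qed

definition L_dual :: "('a \<Rightarrow> real^'n^'n) \<Rightarrow> 'a \<Rightarrow> real^'n^'n" where
  "L_dual Q y = transpose (K y) ** (\<integral>x. g y x *\<^sub>R Q x \<partial>\<mu>) ** K y"

lemma g_Q_integrable:
  fixes Q :: "'a \<Rightarrow> 'b::{banach,second_countable_topology}"
  assumes Q [measurable]: "Q \<in> borel_measurable \<mu>" "AE x in \<mu>. norm (Q x) \<le> q"
    and y: "y \<in> space \<mu>"
  shows "integrable \<mu> (\<lambda>x. g y x *\<^sub>R Q x)"
proof (rule Bochner_Integration.integrable_bound[where f = "\<lambda>x. q * g y x"])
  show "integrable \<mu> (\<lambda>x. q * g y x)" using g_integrable[OF y] by simp
  show "(\<lambda>x. g y x *\<^sub>R Q x) \<in> borel_measurable \<mu>"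
    by (intro borel_measurable_scaleR g_section_measurable y Q)
  show "AE x in \<mu>. norm (g y x *\<^sub>R Q x) \<le> norm (q * g y x)"
    using Q(2) AE_space
  proof eventually_elim
    fix x assume "norm (Q x) \<le> q" "x \<in> space \<mu>"
    then have "norm (Q x) \<le> \<bar>q\<bar>" by linarith
    then show "norm (g y x *\<^sub>R Q x) \<le> norm (q * g y x)"
      by (simp add: abs_mult mult.commute[of "\<bar>q\<bar>"] mult_left_mono)
  qed
qed

lemma L_dual_measurable:
  assumes [measurable]: "Q \<in> borel_measurable \<mu>"
  shows "L_dual Q \<in> borel_measurable \<mu>"
proof -
  have "(\<lambda>p. g (fst p) (snd p) *\<^sub>R Q (snd p)) \<in> borel_measurable (\<mu> \<Otimes>\<^sub>M \<mu>)"
    using g_measurable by (simp add: case_prod_beta')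
  then have "(\<lambda>y. \<integral>x. g y x *\<^sub>R Q x \<partial>\<mu>) \<in> borel_measurable \<mu>"
    by (intro borel_measurable_lebesgue_integral) (simp add: case_prod_beta')
  then show ?thesis
    unfolding L_dual_def[abs_def]
    by (intro borel_measurable_matrix_mult K_measurable
        borel_measurable_bounded_linear[OF bounded_linear_transpose])
qed

text \<open>Fubini's theorem together with \<open>pairing_conj_by\<close>: \<open>L_dual\<close> is the adjoint of \<open>L_op\<close>.\<close>

lemma integral_pairing_L_op:
  assumes Q [measurable]: "Q \<in> borel_measurable \<mu>" and q: "AE x in \<mu>. norm (Q x) \<le> q"
    and V: "integrable \<mu> V"
  shows "(\<integral>x. pairing (Q x) (L_op \<mu> g K V x) \<partial>\<mu>) = (\<integral>y. pairing (L_dual Q y) (V y) \<partial>\<mu>)"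
proof -
  let ?W = "\<lambda>y. conj_by (K y) (V y)"
  note W = conj_by_K_integrable[OF V]
  note right = bounded_bilinear.bounded_linear_right[OF bounded_bilinear_pairing]
  note left = bounded_bilinear.bounded_linear_left[OF bounded_bilinear_pairing]
  obtain a where a: "0 < a" "\<And>(Q :: real^'n^'n) M. norm (pairing Q M) \<le> norm Q * norm M * a"
    using bounded_bilinear.pos_bounded[OF bounded_bilinear_pairing] by blast
  have m: "case_prod (\<lambda>y x. pairing (Q x) (?W y)) \<in> borel_measurable (\<mu> \<Otimes>\<^sub>M \<mu>)"
    unfolding case_prod_beta'
  proof (rule borel_measurable_pairing)
    show "(\<lambda>p. Q (snd p)) \<in> borel_measurable (\<mu> \<Otimes>\<^sub>M \<mu>)" by measurable
    show "(\<lambda>p. ?W (fst p)) \<in> borel_measurable (\<mu> \<Otimes>\<^sub>M \<mu>)"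
      by (rule measurable_compose[OF measurable_fst borel_measurable_integrable[OF W]])
  qed
  have int: "integrable (\<mu> \<Otimes>\<^sub>M \<mu>) (\<lambda>(y, x). g y x *\<^sub>R pairing (Q x) (?W y))"
  proof (rule kernel_integrable(1)[OF m])
    show "integrable \<mu> (\<lambda>y. q * norm (?W y) * a)" using W by simp
    show "AE x in \<mu>. norm (pairing (Q x) (?W y)) \<le> q * norm (?W y) * a" for y
      using q by eventually_elim
        (rule order_trans[OF a(2)], use a in \<open>auto intro!: mult_right_mono\<close>)
  qed
  have "(\<integral>x. pairing (Q x) (L_op \<mu> g K V x) \<partial>\<mu>) = (\<integral>x. \<integral>y. g y x *\<^sub>R pairing (Q x) (?W y) \<partial>\<mu> \<partial>\<mu>)"
  proof (rule integral_cong_AE)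
    show "AE x in \<mu>. pairing (Q x) (L_op \<mu> g K V x) = (\<integral>y. g y x *\<^sub>R pairing (Q x) (?W y) \<partial>\<mu>)"
      using pair.AE_integrable_snd[OF L_op_kernel_integrable(1)[OF V]]
    proof eventually_elim
      fix x assume i: "integrable \<mu> (\<lambda>y. g y x *\<^sub>R ?W y)"
      show "pairing (Q x) (L_op \<mu> g K V x) = (\<integral>y. g y x *\<^sub>R pairing (Q x) (?W y) \<partial>\<mu>)"
        unfolding L_op_conj_by bounded_bilinear.scaleR_right[OF bounded_bilinear_pairing, symmetric]
        by (rule integral_bounded_linear[OF right i, symmetric])
    qed
    show "(\<lambda>x. \<integral>y. g y x *\<^sub>R pairing (Q x) (?W y) \<partial>\<mu>) \<in> borel_measurable \<mu>"
      by (rule borel_measurable_integrable[OF pair.integrable_snd[OF int]])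
    show "(\<lambda>x. pairing (Q x) (L_op \<mu> g K V x)) \<in> borel_measurable \<mu>"
    proof (rule borel_measurable_pairing[OF Q])
      show "L_op \<mu> g K V \<in> borel_measurable \<mu>"
        using H1C_bounded_linearD(1)[OF L_op_bounded_linear, of V] V by (auto simp: H1C_def)
    qed
  qed
  also have "\<dots> = (\<integral>y. \<integral>x. g y x *\<^sub>R pairing (Q x) (?W y) \<partial>\<mu> \<partial>\<mu>)"
    by (rule pair.Fubini_integral[OF int])
  also have "\<dots> = (\<integral>y. pairing (L_dual Q y) (V y) \<partial>\<mu>)"
  proof (rule Bochner_Integration.integral_cong[OF refl])
    fix y assume y: "y \<in> space \<mu>"
    have "(\<integral>x. g y x *\<^sub>R pairing (Q x) (?W y) \<partial>\<mu>) = pairing (\<integral>x. g y x *\<^sub>R Q x \<partial>\<mu>) (?W y)"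
      unfolding bounded_bilinear.scaleR_left[OF bounded_bilinear_pairing, symmetric]
      by (rule integral_bounded_linear[OF left g_Q_integrable[OF Q q y]])
    then show "(\<integral>x. g y x *\<^sub>R pairing (Q x) (?W y) \<partial>\<mu>) = pairing (L_dual Q y) (V y)"
      by (simp add: pairing_conj_by L_dual_def)
  qed
  finally show ?thesis .
qed

end

section \<open>Decay of the powers under a Lyapunov inequality\<close>

lemma bounded_linear_quadratic: "bounded_linear (\<lambda>M :: real^'n^'m. a \<bullet> (M *v b))"
  by (intro bounded_linear_compose[OF bounded_linear_inner_right]
      bounded_bilinear.bounded_linear_left[OF bounded_bilinear_matrix_vector])

lemma inner_axis_mult_axis: "axis i 1 \<bullet> ((M :: real^'n^'m) *v axis j 1) = M $ i $ j"
  by (simp add: inner_axis' matrix_vector_mult_basis column_def)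

definition unit_matrix :: "'n::finite \<Rightarrow> 'n \<Rightarrow> real^'n^'n" where
  "unit_matrix i j = (\<chi> k l. if k = i \<and> l = j then 1 else 0)"

lemma unit_matrix_mult: "u \<bullet> (unit_matrix i j *v v) = u $ i * v $ j"
proof -
  have "unit_matrix i j *v v = axis i (v $ j)"
    by (auto simp: unit_matrix_def matrix_vector_mult_def vec_eq_iff axis_def if_distrib
        if_distribR cong: if_cong)
  then show ?thesis by (simp add: inner_axis)
qed

lemma pairing_unit_matrix: "pairing (s *\<^sub>R unit_matrix i j) M = s *\<^sub>R M $ i $ j"
proof -
  have "pairing (s *\<^sub>R unit_matrix i j) M
      = (\<Sum>l\<in>UNIV. \<Sum>k\<in>UNIV. if k = i then if l = j then s *\<^sub>R M $ k $ l else 0 else 0)"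
    unfolding pairing_eq_sum by (intro sum.cong refl) (simp add: unit_matrix_def)
  then show ?thesis by simp
qed

text \<open>The last assumption says that \<open>L_dual P \<le> \<alpha> P\<close> in the order of symmetric matrices.\<close>

locale lyapunov_chain = weighted_chain \<mu> g K b
  for \<mu> :: "'a measure" and g and K :: "'a \<Rightarrow> real^'n^'n" and b +
  fixes P :: "'a \<Rightarrow> real^'n^'n" and \<alpha> p pb :: real
  assumes P_measurable [measurable]: "P \<in> borel_measurable \<mu>"
    and P_bounded: "AE x in \<mu>. norm (P x) \<le> pb"
    and p: "0 < p" and P_ge: "AE x in \<mu>. \<forall>u. p * (u \<bullet> u) \<le> u \<bullet> (P x *v u)"
    and \<alpha>: "0 \<le> \<alpha>"
    and lyapunov: "AE y in \<mu>. \<forall>h. (\<integral>x. g y x * ((K y *v h) \<bullet> (P x *v (K y *v h))) \<partial>\<mu>)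
      \<le> \<alpha> * (h \<bullet> (P y *v h))"
begin

text \<open>An unsymmetric matrix field measured against \<open>P\<close>.  By rescaling \<open>u\<close> and \<open>v\<close>, the condition is
  equivalent to the bound of \<open>u \<bullet> Q v\<close> by \<open>t\<close> times the product of the \<open>P\<close>-norms of \<open>u\<close> and \<open>v\<close>.
  In the form with a sum the right-hand side can be integrated term by term, which spares the
  Cauchy-Schwarz inequality.\<close>

definition dominated :: "real \<Rightarrow> ('a \<Rightarrow> real^'n^'n) \<Rightarrow> bool" where
  "dominated t Q \<longleftrightarrow> Q \<in> borel_measurable \<mu> \<and>
    (AE y in \<mu>. \<forall>u v. 2 * (u \<bullet> (Q y *v v)) \<le> t * (u \<bullet> (P y *v u) + v \<bullet> (P y *v v)))"

text \<open>Basis vectors and their negatives as \<open>u\<close> and \<open>v\<close> bound the entries of \<open>Q\<close> from both sides.\<close>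

lemma dominated_bound:
  assumes Q: "dominated t Q" and t: "0 \<le> t"
  shows "AE y in \<mu>. norm (Q y) \<le> real (CARD('n) * CARD('n)) * (t * pb)"
proof -
  have "AE y in \<mu>. \<forall>u v. 2 * (u \<bullet> (Q y *v v)) \<le> t * (u \<bullet> (P y *v u) + v \<bullet> (P y *v v))"
    using Q by (simp add: dominated_def)
  with P_bounded show ?thesis
  proof eventually_elim
    fix y
    assume pb: "norm (P y) \<le> pb"
      and dom: "\<forall>u v. 2 * (u \<bullet> (Q y *v v)) \<le> t * (u \<bullet> (P y *v u) + v \<bullet> (P y *v v))"
    have entry: "\<bar>Q y $ i $ j\<bar> \<le> t * pb" for i j
    proof -
      let ?e = "\<lambda>i. axis i 1 :: real^'n"
      have diag: "P y $ i $ i \<le> pb" for i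
        using norm_entry_le[of "P y" i i] pb by simp
      have "t * (P y $ i $ i + P y $ j $ j) \<le> t * (2 * pb)"
        using diag[of i] diag[of j] by (intro mult_left_mono t) simp
      moreover have "2 * (Q y $ i $ j) \<le> t * (P y $ i $ i + P y $ j $ j)"
        using dom[rule_format, of "?e i" "?e j"] by (simp add: inner_axis_mult_axis)
      moreover have "- (2 * (Q y $ i $ j)) \<le> t * (P y $ i $ i + P y $ j $ j)"
        using dom[rule_format, of "- ?e i" "?e j"]
        by (simp add: inner_axis_mult_axis linear_neg[OF matrix_vector_mul_linear])
      ultimately show ?thesis by (simp add: abs_le_iff)
    qed
    have "norm (Q y) \<le> (\<Sum>i\<in>UNIV. \<Sum>j\<in>UNIV. norm (Q y $ i $ j))"
      by (rule norm_le_sum_entries)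
    also have "\<dots> \<le> (\<Sum>i\<in>(UNIV::'n set). \<Sum>j\<in>(UNIV::'n set). t * pb)"
      by (intro sum_mono) (use entry in simp)
    finally show "norm (Q y) \<le> real (CARD('n) * CARD('n)) * (t * pb)" by simp
  qed
qed

text \<open>By definition of \<open>L_dual\<close>, \<open>u \<bullet> L_dual Q y v\<close> is the mean of \<open>K y u \<bullet> Q x (K y v)\<close> over the next
  state \<open>x\<close>.  Domination bounds the integrand by a sum of two quadratic forms of \<open>P x\<close>, in \<open>K y u\<close>
  and in \<open>K y v\<close>, and the Lyapunov inequality applies to each of them.\<close>

lemma dominated_L_dual:
  assumes Q: "dominated t Q" and t: "0 \<le> t"
  shows "dominated (\<alpha> * t) (L_dual Q)"
  unfolding dominated_def
proof
  have Qm: "Q \<in> borel_measurable \<mu>" using Q by (simp add: dominated_def)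
  show "L_dual Q \<in> borel_measurable \<mu>" by (rule L_dual_measurable[OF Qm])
  have Qd: "AE x in \<mu>. \<forall>u v. 2 * (u \<bullet> (Q x *v v)) \<le> t * (u \<bullet> (P x *v u) + v \<bullet> (P x *v v))"
    using Q by (simp add: dominated_def)
  show "AE y in \<mu>. \<forall>u v. 2 * (u \<bullet> (L_dual Q y *v v))
      \<le> \<alpha> * t * (u \<bullet> (P y *v u) + v \<bullet> (P y *v v))"
    using lyapunov AE_space
  proof eventually_elim
    fix y
    assume lyap: "\<forall>h. (\<integral>x. g y x * ((K y *v h) \<bullet> (P x *v (K y *v h))) \<partial>\<mu>) \<le> \<alpha> * (h \<bullet> (P y *v h))"
      and y: "y \<in> space \<mu>"
    have iQ: "integrable \<mu> (\<lambda>x. g y x *\<^sub>R Q x)"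
      by (rule g_Q_integrable[OF Qm dominated_bound[OF Q t] y])
    have iP: "integrable \<mu> (\<lambda>x. g y x *\<^sub>R P x)"
      by (rule g_Q_integrable[OF P_measurable P_bounded y])
    show "\<forall>u v. 2 * (u \<bullet> (L_dual Q y *v v)) \<le> \<alpha> * t * (u \<bullet> (P y *v u) + v \<bullet> (P y *v v))"
    proof (intro allI)
      fix u v :: "real^'n"
      define c where "c = K y *v u"
      define d where "d = K y *v v"
      have scale: "e \<bullet> ((s *\<^sub>R M) *v f) = s * (e \<bullet> (M *v f))" for e f s and M :: "real^'n^'n"
        using linear_cmul[OF bounded_linear.linear[OF bounded_linear_quadratic]] by simp
      have ig: "integrable \<mu> (\<lambda>x. g y x * (c \<bullet> (Q x *v d)))"
        using integrable_bounded_linear[OF bounded_linear_quadratic iQ, of c d]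
        by (simp add: scale)
      have ic: "integrable \<mu> (\<lambda>x. g y x * (c \<bullet> (P x *v c)))"
        using integrable_bounded_linear[OF bounded_linear_quadratic iP, of c c]
        by (simp add: scale)
      have id: "integrable \<mu> (\<lambda>x. g y x * (d \<bullet> (P x *v d)))"
        using integrable_bounded_linear[OF bounded_linear_quadratic iP, of d d]
        by (simp add: scale)
      have "u \<bullet> (L_dual Q y *v v) = c \<bullet> ((\<integral>x. g y x *\<^sub>R Q x \<partial>\<mu>) *v d)"
        by (simp add: L_dual_def c_def d_def inner_transpose_mult
            matrix_vector_mul_assoc[symmetric] del: transpose_matrix_vector)
      also have "\<dots> = (\<integral>x. g y x * (c \<bullet> (Q x *v d)) \<partial>\<mu>)"
        using integral_bounded_linear[OF bounded_linear_quadratic iQ, of c d]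
        by (simp add: scale)
      finally have "2 * (u \<bullet> (L_dual Q y *v v)) = (\<integral>x. 2 * (g y x * (c \<bullet> (Q x *v d))) \<partial>\<mu>)"
        by simp
      also have "\<dots> \<le> (\<integral>x. t * (g y x * (c \<bullet> (P x *v c)) + g y x * (d \<bullet> (P x *v d))) \<partial>\<mu>)"
      proof (rule integral_mono_AE)
        show "integrable \<mu> (\<lambda>x. 2 * (g y x * (c \<bullet> (Q x *v d))))" using ig by simp
        show "integrable \<mu> (\<lambda>x. t * (g y x * (c \<bullet> (P x *v c)) + g y x * (d \<bullet> (P x *v d))))"
          using ic id by simp
        show "AE x in \<mu>. 2 * (g y x * (c \<bullet> (Q x *v d)))
            \<le> t * (g y x * (c \<bullet> (P x *v c)) + g y x * (d \<bullet> (P x *v d)))"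
          using Qd AE_space
        proof eventually_elim
          fix x
          assume "\<forall>u v. 2 * (u \<bullet> (Q x *v v)) \<le> t * (u \<bullet> (P x *v u) + v \<bullet> (P x *v v))"
            and x: "x \<in> space \<mu>"
          then have "g y x * (2 * (c \<bullet> (Q x *v d))) \<le> g y x * (t * (c \<bullet> (P x *v c) + d \<bullet> (P x *v d)))"
            by (intro mult_left_mono g_nonneg[OF y]) auto
          then show "2 * (g y x * (c \<bullet> (Q x *v d)))
              \<le> t * (g y x * (c \<bullet> (P x *v c)) + g y x * (d \<bullet> (P x *v d)))"
            by (simp add: algebra_simps)
        qed
      qed
      also have "\<dots> = t * ((\<integral>x. g y x * (c \<bullet> (P x *v c)) \<partial>\<mu>) + (\<integral>x. g y x * (d \<bullet> (P x *v d)) \<partial>\<mu>))"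
        using ic id by simp
      also have "\<dots> \<le> t * (\<alpha> * (u \<bullet> (P y *v u)) + \<alpha> * (v \<bullet> (P y *v v)))"
        unfolding c_def d_def by (intro mult_left_mono add_mono lyap[rule_format] t)
      finally show "2 * (u \<bullet> (L_dual Q y *v v)) \<le> \<alpha> * t * (u \<bullet> (P y *v u) + v \<bullet> (P y *v v))"
        by (simp add: algebra_simps)
    qed
  qed
qed

lemma dominated_funpow:
  assumes Q: "dominated t Q" and t: "0 \<le> t"
  obtains Q' where "dominated (\<alpha> ^ k * t) Q'"
    "\<And>V. V \<in> H1C \<mu> \<Longrightarrow>
      (\<integral>x. pairing (Q x) ((L_op \<mu> g K ^^ k) V x) \<partial>\<mu>) = (\<integral>x. pairing (Q' x) (V x) \<partial>\<mu>)"
proof -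
  have "\<exists>Q'. dominated (\<alpha> ^ k * t) Q' \<and> (\<forall>V \<in> H1C \<mu>.
      (\<integral>x. pairing (Q x) ((L_op \<mu> g K ^^ k) V x) \<partial>\<mu>) = (\<integral>x. pairing (Q' x) (V x) \<partial>\<mu>))"
  proof (induction k)
    case 0
    show ?case using Q by auto
  next
    case (Suc k)
    then obtain Q' where Q': "dominated (\<alpha> ^ k * t) Q'"
      and eq: "\<And>V. V \<in> H1C \<mu> \<Longrightarrow>
        (\<integral>x. pairing (Q x) ((L_op \<mu> g K ^^ k) V x) \<partial>\<mu>) = (\<integral>x. pairing (Q' x) (V x) \<partial>\<mu>)"
      by blast
    have t': "0 \<le> \<alpha> ^ k * t" using \<alpha> t by simp
    have "(\<integral>x. pairing (Q x) ((L_op \<mu> g K ^^ Suc k) V x) \<partial>\<mu>) = (\<integral>x. pairing (L_dual Q' x) (V x) \<partial>\<mu>)"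
      if V: "V \<in> H1C \<mu>" for V
    proof -
      have "(\<integral>x. pairing (Q x) ((L_op \<mu> g K ^^ Suc k) V x) \<partial>\<mu>)
          = (\<integral>x. pairing (Q' x) (L_op \<mu> g K V x) \<partial>\<mu>)"
        using eq[OF H1C_bounded_linearD(1)[OF L_op_bounded_linear V]] by (simp add: funpow_swap1)
      also have "\<dots> = (\<integral>x. pairing (L_dual Q' x) (V x) \<partial>\<mu>)"
        by (rule integral_pairing_L_op[OF _ dominated_bound[OF Q' t']])
          (use Q' V in \<open>auto simp: dominated_def H1C_def\<close>)
      finally show ?thesis .
    qed
    moreover have "dominated (\<alpha> ^ Suc k * t) (L_dual Q')"
      using dominated_L_dual[OF Q' t'] by (simp add: ac_simps)
    ultimately show ?case by blast
  qed
  then show ?thesis using that by blast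
qed

lemma dominated_unit_matrix:
  assumes s: "s \<in> borel_measurable \<mu>" "\<And>y. \<bar>s y\<bar> \<le> 1"
  shows "dominated (1 / p) (\<lambda>y. s y *\<^sub>R unit_matrix i j)"
  unfolding dominated_def
proof
  show "(\<lambda>y. s y *\<^sub>R unit_matrix i j) \<in> borel_measurable \<mu>" using s(1) by simp
  show "AE y in \<mu>. \<forall>u v. 2 * (u \<bullet> ((s y *\<^sub>R unit_matrix i j) *v v))
      \<le> 1 / p * (u \<bullet> (P y *v u) + v \<bullet> (P y *v v))"
    using P_ge
  proof eventually_elim
    fix y assume ge: "\<forall>u. p * (u \<bullet> u) \<le> u \<bullet> (P y *v u)"
    show "\<forall>u v. 2 * (u \<bullet> ((s y *\<^sub>R unit_matrix i j) *v v))
      \<le> 1 / p * (u \<bullet> (P y *v u) + v \<bullet> (P y *v v))"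
    proof (intro allI)
      fix u v :: "real^'n"
      have le: "\<bar>w $ k\<bar> ^ 2 \<le> w \<bullet> w" for w :: "real^'n" and k
        using power_mono[OF component_le_norm_cart[of w k], of 2] by (simp add: power2_norm_eq_inner)
      have "2 * (u \<bullet> ((s y *\<^sub>R unit_matrix i j) *v v)) = 2 * (s y * (u $ i * v $ j))"
        using unit_matrix_mult[of u i j v]
          linear_cmul[OF bounded_linear.linear[OF bounded_linear_quadratic], of u "s y" "unit_matrix i j" v]
        by simp
      also have "\<dots> \<le> 2 * (\<bar>s y\<bar> * (\<bar>u $ i\<bar> * \<bar>v $ j\<bar>))"
        by (simp add: abs_mult[symmetric])
      also have "\<dots> \<le> 2 * (1 * (\<bar>u $ i\<bar> * \<bar>v $ j\<bar>))"
        by (intro mult_left_mono mult_right_mono s(2)) auto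
      also have "\<dots> \<le> \<bar>u $ i\<bar> ^ 2 + \<bar>v $ j\<bar> ^ 2"
        using sum_squares_bound[of "\<bar>u $ i\<bar>" "\<bar>v $ j\<bar>"] by simp
      also have "\<dots> \<le> u \<bullet> u + v \<bullet> v"
        by (intro add_mono le)
      also have "\<dots> \<le> 1 / p * (u \<bullet> (P y *v u) + v \<bullet> (P y *v v))"
        using ge[rule_format, of u] ge[rule_format, of v] p by (simp add: field_simps)
      finally show "2 * (u \<bullet> ((s y *\<^sub>R unit_matrix i j) *v v))
        \<le> 1 / p * (u \<bullet> (P y *v u) + v \<bullet> (P y *v v))" .
    qed
  qed
qed

text \<open>Duality between \<open>L\<^sup>1\<close> and \<open>L\<^sup>\<infinity>\<close>, one entry at a time: the \<open>L\<^sup>1\<close> norm is attained by pairing with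
  the sign of the entry.  Moved to the other side, the \<open>k\<close>-th power contributes the factor
  \<open>\<alpha> ^ k\<close>.  The functional \<open>f\<close> stands for the real or the imaginary part, which keeps the test
  fields real.\<close>

lemma L_op_funpow_entry_decay:
  fixes f :: "complex \<Rightarrow> real"
  assumes f: "bounded_linear f" "\<And>w. \<bar>f w\<bar> \<le> cmod w"
    and a: "0 \<le> a" "\<And>(Q :: real^'n^'n) M. cmod (pairing Q M) \<le> norm Q * norm M * a"
    and V: "V \<in> H1C \<mu>"
  shows "(\<integral>x. \<bar>f ((L_op \<mu> g K ^^ k) V x $ i $ j)\<bar> \<partial>\<mu>)
    \<le> real (CARD('n) * CARD('n)) * (\<alpha> ^ k * (1 / p) * pb) * a * (\<integral>x. norm (V x) \<partial>\<mu>)"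
proof -
  define U where "U = (L_op \<mu> g K ^^ k) V"
  define s where "s = (\<lambda>y. sgn (f (U y $ i $ j)))"
  let ?Q = "\<lambda>y. s y *\<^sub>R unit_matrix i j"
  let ?n = "real (CARD('n) * CARD('n))"
  have U: "integrable \<mu> U"
    using H1C_bounded_linearD(1)[OF H1C_bounded_linear_funpow[OF L_op_bounded_linear] V]
    by (simp add: U_def H1C_def)
  have Uij: "integrable \<mu> (\<lambda>y. U y $ i $ j)"
    by (intro integrable_bounded_linear[OF bounded_linear_vec_nth] U)
  have fU: "integrable \<mu> (\<lambda>y. f (U y $ i $ j))"
    by (rule integrable_bounded_linear[OF f(1) Uij])
  have s: "s \<in> borel_measurable \<mu>" "\<bar>s y\<bar> \<le> 1" for y
    using borel_measurable_integrable[OF fU] by (auto simp: s_def abs_sgn_eq)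
  have sU: "integrable \<mu> (\<lambda>y. s y *\<^sub>R U y $ i $ j)"
  proof (rule Bochner_Integration.integrable_bound[OF Uij])
    show "(\<lambda>y. s y *\<^sub>R U y $ i $ j) \<in> borel_measurable \<mu>"
      by (intro borel_measurable_scaleR s borel_measurable_integrable[OF Uij])
    show "AE y in \<mu>. norm (s y *\<^sub>R U y $ i $ j) \<le> norm (U y $ i $ j)"
      using s(2) by (simp add: mult_left_le_one_le)
  qed
  have p0: "0 \<le> 1 / p" using p by simp
  obtain Q' where Q': "dominated (\<alpha> ^ k * (1 / p)) Q'"
    and eq: "\<And>V. V \<in> H1C \<mu> \<Longrightarrow>
      (\<integral>x. pairing (?Q x) ((L_op \<mu> g K ^^ k) V x) \<partial>\<mu>) = (\<integral>x. pairing (Q' x) (V x) \<partial>\<mu>)"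
    using dominated_funpow[OF dominated_unit_matrix[OF s], of k i j] p0 by blast
  have Q'_bound: "AE x in \<mu>. norm (Q' x) \<le> ?n * (\<alpha> ^ k * (1 / p) * pb)"
    by (rule dominated_bound[OF Q']) (use \<alpha> p in simp)
  have "(\<integral>x. \<bar>f (U x $ i $ j)\<bar> \<partial>\<mu>) = (\<integral>x. f (s x *\<^sub>R U x $ i $ j) \<partial>\<mu>)"
    unfolding linear_cmul[OF bounded_linear.linear[OF f(1)]]
    by (simp add: s_def abs_sgn mult.commute)
  also have "\<dots> = f (\<integral>x. s x *\<^sub>R U x $ i $ j \<partial>\<mu>)"
    by (rule integral_bounded_linear[OF f(1) sU])
  also have "\<dots> = f (\<integral>x. pairing (Q' x) (V x) \<partial>\<mu>)"
    using eq[OF V] by (simp add: pairing_unit_matrix U_def)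
  also have "\<dots> \<le> cmod (\<integral>x. pairing (Q' x) (V x) \<partial>\<mu>)"
    by (rule order_trans[OF abs_ge_self f(2)])
  also have "\<dots> \<le> (\<integral>x. cmod (pairing (Q' x) (V x)) \<partial>\<mu>)"
    by (rule integral_norm_bound)
  also have "\<dots> \<le> (\<integral>x. ?n * (\<alpha> ^ k * (1 / p) * pb) * a * norm (V x) \<partial>\<mu>)"
  proof -
    have le: "AE x in \<mu>. cmod (pairing (Q' x) (V x)) \<le> ?n * (\<alpha> ^ k * (1 / p) * pb) * a * norm (V x)"
      using Q'_bound
    proof eventually_elim
      fix x assume "norm (Q' x) \<le> ?n * (\<alpha> ^ k * (1 / p) * pb)"
      then have "norm (Q' x) * norm (V x) * a \<le> ?n * (\<alpha> ^ k * (1 / p) * pb) * norm (V x) * a"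
        by (intro mult_right_mono a) auto
      with a(2)[of "Q' x" "V x"]
      show "cmod (pairing (Q' x) (V x)) \<le> ?n * (\<alpha> ^ k * (1 / p) * pb) * a * norm (V x)"
        by (simp add: ac_simps)
    qed
    have dom: "integrable \<mu> (\<lambda>x. ?n * (\<alpha> ^ k * (1 / p) * pb) * a * norm (V x))"
      using V by (simp add: H1C_def)
    have "integrable \<mu> (\<lambda>x. pairing (Q' x) (V x))"
    proof (rule Bochner_Integration.integrable_bound[OF dom])
      show "(\<lambda>x. pairing (Q' x) (V x)) \<in> borel_measurable \<mu>"
        using Q' V by (intro borel_measurable_pairing) (auto simp: dominated_def H1C_def)
      show "AE x in \<mu>. cmod (pairing (Q' x) (V x))
          \<le> norm (?n * (\<alpha> ^ k * (1 / p) * pb) * a * norm (V x))"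
        using le unfolding real_norm_def by eventually_elim (rule order_trans[OF _ abs_ge_self])
    qed
    from integral_mono_AE[OF integrable_norm[OF this] dom le] show ?thesis .
  qed
  finally show ?thesis by (simp add: U_def)
qed

lemma L_op_funpow_decay:
  obtains C where "0 \<le> C" "\<And>k V. V \<in> H1C \<mu> \<Longrightarrow>
    (\<integral>x. norm ((L_op \<mu> g K ^^ k) V x) \<partial>\<mu>) \<le> C * \<alpha> ^ k * (\<integral>x. norm (V x) \<partial>\<mu>)"
proof -
  let ?n = "real (CARD('n) * CARD('n))"
  obtain a where a: "0 < a" "\<And>(Q :: real^'n^'n) M. norm (pairing Q M) \<le> norm Q * norm M * a"
    using bounded_bilinear.pos_bounded[OF bounded_bilinear_pairing] by blast
  define C where "C = ?n * (1 / p * pb) * a"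
  have main: "(\<integral>x. norm ((L_op \<mu> g K ^^ k) V x) \<partial>\<mu>) \<le> (?n * (2 * C)) * \<alpha> ^ k * (\<integral>x. norm (V x) \<partial>\<mu>)"
    if V: "V \<in> H1C \<mu>" for k V
  proof -
    define U where "U = (L_op \<mu> g K ^^ k) V"
    have U: "integrable \<mu> U"
      using H1C_bounded_linearD(1)[OF H1C_bounded_linear_funpow[OF L_op_bounded_linear] V]
      by (simp add: U_def H1C_def)
    have Uij: "integrable \<mu> (\<lambda>y. U y $ i $ j)" for i j
      by (intro integrable_bounded_linear[OF bounded_linear_vec_nth] U)
    have re: "integrable \<mu> (\<lambda>y. \<bar>Re (U y $ i $ j)\<bar>)" and im: "integrable \<mu> (\<lambda>y. \<bar>Im (U y $ i $ j)\<bar>)" for i j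
      using integrable_bounded_linear[OF bounded_linear_Re Uij, of i j]
        integrable_bounded_linear[OF bounded_linear_Im Uij, of i j] by simp_all
    have "(\<integral>x. norm (U x) \<partial>\<mu>) \<le> (\<integral>x. (\<Sum>i\<in>UNIV. \<Sum>j\<in>UNIV. \<bar>Re (U x $ i $ j)\<bar> + \<bar>Im (U x $ i $ j)\<bar>) \<partial>\<mu>)"
    proof (rule integral_mono)
      show "integrable \<mu> (\<lambda>x. norm (U x))" using U by simp
      show "integrable \<mu> (\<lambda>x. \<Sum>i\<in>UNIV. \<Sum>j\<in>UNIV. \<bar>Re (U x $ i $ j)\<bar> + \<bar>Im (U x $ i $ j)\<bar>)"
        by (intro Bochner_Integration.integrable_sum Bochner_Integration.integrable_add re im)
      show "norm (U x) \<le> (\<Sum>i\<in>UNIV. \<Sum>j\<in>UNIV. \<bar>Re (U x $ i $ j)\<bar> + \<bar>Im (U x $ i $ j)\<bar>)" for x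
        by (rule order_trans[OF norm_le_sum_entries]) (intro sum_mono cmod_le)
    qed
    also have "\<dots> = (\<Sum>i\<in>UNIV. \<Sum>j\<in>UNIV. (\<integral>x. \<bar>Re (U x $ i $ j)\<bar> \<partial>\<mu>) + (\<integral>x. \<bar>Im (U x $ i $ j)\<bar> \<partial>\<mu>))"
      using re im by simp
    also have "\<dots> \<le> (\<Sum>i\<in>(UNIV::'n set). \<Sum>j\<in>(UNIV::'n set).
        C * \<alpha> ^ k * (\<integral>x. norm (V x) \<partial>\<mu>) + C * \<alpha> ^ k * (\<integral>x. norm (V x) \<partial>\<mu>))"
    proof (intro sum_mono add_mono)
      fix i j :: 'n
      show "(\<integral>x. \<bar>Re (U x $ i $ j)\<bar> \<partial>\<mu>) \<le> C * \<alpha> ^ k * (\<integral>x. norm (V x) \<partial>\<mu>)"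
        using L_op_funpow_entry_decay[OF bounded_linear_Re abs_Re_le_cmod less_imp_le[OF a(1)] a(2) V, of k i j]
        by (simp add: U_def C_def ac_simps)
      show "(\<integral>x. \<bar>Im (U x $ i $ j)\<bar> \<partial>\<mu>) \<le> C * \<alpha> ^ k * (\<integral>x. norm (V x) \<partial>\<mu>)"
        using L_op_funpow_entry_decay[OF bounded_linear_Im abs_Im_le_cmod less_imp_le[OF a(1)] a(2) V, of k i j]
        by (simp add: U_def C_def ac_simps)
    qed
    finally show ?thesis by (simp add: U_def algebra_simps)
  qed
  show ?thesis
  proof (rule that[of "\<bar>?n * (2 * C)\<bar>"])
    fix k and V :: "'a \<Rightarrow> complex^'n^'n" assume "V \<in> H1C \<mu>"
    from main[OF this, of k]
    have "(\<integral>x. norm ((L_op \<mu> g K ^^ k) V x) \<partial>\<mu>) \<le> (?n * (2 * C)) * \<alpha> ^ k * (\<integral>x. norm (V x) \<partial>\<mu>)" .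
    also have "\<dots> \<le> \<bar>?n * (2 * C)\<bar> * \<alpha> ^ k * (\<integral>x. norm (V x) \<partial>\<mu>)"
      by (intro mult_right_mono abs_ge_self) (use \<alpha> in auto)
    finally show "(\<integral>x. norm ((L_op \<mu> g K ^^ k) V x) \<partial>\<mu>) \<le> \<bar>?n * (2 * C)\<bar> * \<alpha> ^ k * (\<integral>x. norm (V x) \<partial>\<mu>)" .
  qed simp
qed

theorem L_op_spectral_radius_le: "H1C_spectral_radius \<mu> (L_op \<mu> g K) \<le> ennreal \<alpha>"
proof -
  obtain C where C: "0 \<le> C" "\<And>k V. V \<in> H1C \<mu> \<Longrightarrow>
    (\<integral>x. norm ((L_op \<mu> g K ^^ k) V x) \<partial>\<mu>) \<le> C * \<alpha> ^ k * (\<integral>x. norm (V x) \<partial>\<mu>)"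
    using L_op_funpow_decay by blast
  show ?thesis by (rule H1C_spectral_radius_le[OF L_op_bounded_linear \<alpha> C])
qed

end

section \<open>Piecewise constant Lyapunov functions and gains\<close>

lemma is_box_borel:
  fixes S :: "(real^'p) set"
  assumes "is_box S"
  shows "S \<in> sets borel"
proof -
  obtain I where I: "\<And>i. is_interval (I i)" and S: "S = {x. \<forall>i. x $ i \<in> I i}"
    using assms unfolding is_box_def by blast
  have "S = (\<Inter>i. (\<lambda>x. x $ i) -` I i \<inter> space borel)" unfolding S by auto
  also have "\<dots> \<in> sets borel"
  proof (rule sets.finite_INT)
    fix i
    show "(\<lambda>x. x $ i) -` I i \<inter> space borel \<in> sets borel"
      by (rule measurable_sets[OF _ real_interval_borel_measurable[OF I]])
        (intro borel_measurable_continuous_onI continuous_intros)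
  qed auto
  finally show ?thesis .
qed

definition piecewise :: "('k::finite \<Rightarrow> 'a set) \<Rightarrow> ('k \<Rightarrow> 'b::real_vector) \<Rightarrow> 'a \<Rightarrow> 'b" where
  "piecewise S M x = (\<Sum>j\<in>UNIV. indicator (S j) x *\<^sub>R M j)"

lemma piecewise_eq:
  assumes "disjoint_family S" "x \<in> S i"
  shows "piecewise S M x = M i"
proof -
  have "indicator (S j) x *\<^sub>R M j = (if j = i then M j else 0)" for j
    using assms by (auto simp: disjoint_family_on_def indicator_def)
  then show ?thesis by (simp only: piecewise_def) simp
qed

lemma piecewise_measurable:
  fixes M :: "'k::finite \<Rightarrow> 'b::euclidean_space"
  assumes "\<And>j. S j \<in> sets \<mu>"
  shows "piecewise S M \<in> borel_measurable \<mu>"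
  unfolding piecewise_def[abs_def]
  by (intro borel_measurable_sum borel_measurable_scaleR borel_measurable_indicator assms) simp

context weighted_chain
begin

lemma integral_piecewise_quadratic:
  fixes M :: "'k::finite \<Rightarrow> real^'m^'m"
  assumes S: "\<And>j. S j \<in> sets \<mu>" and y: "y \<in> space \<mu>"
  shows "(\<integral>x. g y x * (z \<bullet> (piecewise S M x *v z)) \<partial>\<mu>)
    = (\<Sum>j\<in>UNIV. (LINT x:S j|\<mu>. g y x) * (z \<bullet> (M j *v z)))"
proof -
  have "z \<bullet> (piecewise S M x *v z) = (\<Sum>j\<in>UNIV. indicator (S j) x * (z \<bullet> (M j *v z)))" for x
    unfolding piecewise_def
    by (simp add: linear_sum[OF bounded_linear.linear[OF bounded_linear_quadratic]]
        linear_cmul[OF bounded_linear.linear[OF bounded_linear_quadratic]])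
  note quad = this
  have "(\<integral>x. g y x * (z \<bullet> (piecewise S M x *v z)) \<partial>\<mu>)
      = (\<integral>x. (\<Sum>j\<in>UNIV. (indicator (S j) x *\<^sub>R g y x) * (z \<bullet> (M j *v z))) \<partial>\<mu>)"
    unfolding quad sum_distrib_left
    by (intro Bochner_Integration.integral_cong refl sum.cong) (simp only: real_scaleR_def ac_simps)
  also have "\<dots> = (\<Sum>j\<in>UNIV. \<integral>x. (indicator (S j) x *\<^sub>R g y x) * (z \<bullet> (M j *v z)) \<partial>\<mu>)"
    by (intro Bochner_Integration.integral_sum integrable_mult_left
        integrable_mult_indicator S g_integrable y)
  also have "\<dots> = (\<Sum>j\<in>UNIV. (LINT x:S j|\<mu>. g y x) * (z \<bullet> (M j *v z)))"
    by (simp add: set_lebesgue_integral_def)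
  finally show ?thesis .
qed

lemma set_integral_g_nonneg:
  assumes y: "y \<in> space \<mu>"
  shows "0 \<le> (LINT x:S|\<mu>. g y x)"
  unfolding set_lebesgue_integral_def
  by (rule Bochner_Integration.integral_nonneg_AE) (use y in \<open>auto intro!: AE_I2 mult_nonneg_nonneg g_nonneg\<close>)

text \<open>If \<open>P\<close> is constant on each set of a finite partition, its mean over the next state is a finite
  sum whose weights are the transition probabilities into these sets.\<close>

lemma piecewise_lyapunov_spectral_radius:
  fixes M :: "'k::finite \<Rightarrow> real^'n^'n"
  assumes S: "\<And>j. S j \<in> sets \<mu>" and disj: "disjoint_family S" and cover: "(\<Union>j. S j) = space \<mu>"
    and M: "\<And>j x. x \<noteq> 0 \<Longrightarrow> 0 < x \<bullet> (M j *v x)"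
    and \<alpha>: "0 \<le> \<alpha>"
    and lyap: "\<And>i. AE y in \<mu>. y \<in> S i \<longrightarrow> (\<forall>h.
      (\<Sum>j\<in>UNIV. (LINT x:S j|\<mu>. g y x) * ((K y *v h) \<bullet> (M j *v (K y *v h)))) \<le> \<alpha> * (h \<bullet> (M i *v h)))"
  shows "H1C_spectral_radius \<mu> (L_op \<mu> g K) \<le> ennreal \<alpha>"
proof -
  have "\<exists>e>0. \<forall>x. e * (x \<bullet> x) \<le> x \<bullet> (M j *v x)" for j
    using quadratic_form_lower_bound[of "M j"] M by metis
  then obtain e where e: "\<And>j. 0 < e j" "\<And>j x. e j * (x \<bullet> x) \<le> x \<bullet> (M j *v x)" by metis
  define p where "p = Min (range e)"
  have p: "0 < p" "p \<le> e j" for j using e(1) by (auto simp: p_def Min_gr_iff)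
  define P where "P = piecewise S M"
  have P: "P x = M i" if "x \<in> S i" for x i
    unfolding P_def by (rule piecewise_eq[OF disj that])
  have cases: "\<exists>i. x \<in> S i" if "x \<in> space \<mu>" for x using cover that by blast
  interpret lyapunov_chain \<mu> g K b P \<alpha> p "\<Sum>j\<in>UNIV. norm (M j)"
  proof
    show "P \<in> borel_measurable \<mu>" unfolding P_def by (rule piecewise_measurable[OF S])
    show "AE x in \<mu>. norm (P x) \<le> (\<Sum>j\<in>UNIV. norm (M j))"
    proof (rule AE_I2)
      fix x assume "x \<in> space \<mu>"
      then obtain i where "x \<in> S i" using cases by blast
      then show "norm (P x) \<le> (\<Sum>j\<in>UNIV. norm (M j))"
        using member_le_sum[of i UNIV "\<lambda>j. norm (M j)"] by (simp add: P)
    qed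
    show "0 < p" by (rule p)
    show "AE x in \<mu>. \<forall>u. p * (u \<bullet> u) \<le> u \<bullet> (P x *v u)"
    proof (rule AE_I2, rule allI)
      fix x and u :: "real^'n" assume "x \<in> space \<mu>"
      then obtain i where i: "x \<in> S i" using cases by blast
      have "p * (u \<bullet> u) \<le> e i * (u \<bullet> u)" by (intro mult_right_mono p) simp
      also have "\<dots> \<le> u \<bullet> (P x *v u)" unfolding P[OF i] by (rule e)
      finally show "p * (u \<bullet> u) \<le> u \<bullet> (P x *v u)" .
    qed
    show "0 \<le> \<alpha>" by (rule \<alpha>)
    have "AE y in \<mu>. \<forall>i. y \<in> S i \<longrightarrow> (\<forall>h.
      (\<Sum>j\<in>UNIV. (LINT x:S j|\<mu>. g y x) * ((K y *v h) \<bullet> (M j *v (K y *v h)))) \<le> \<alpha> * (h \<bullet> (M i *v h)))"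
      unfolding AE_all_countable using lyap by blast
    then show "AE y in \<mu>. \<forall>h. (\<integral>x. g y x * ((K y *v h) \<bullet> (P x *v (K y *v h))) \<partial>\<mu>)
        \<le> \<alpha> * (h \<bullet> (P y *v h))"
      using AE_space
    proof eventually_elim
      fix y
      assume *: "\<forall>i. y \<in> S i \<longrightarrow> (\<forall>h.
          (\<Sum>j\<in>UNIV. (LINT x:S j|\<mu>. g y x) * ((K y *v h) \<bullet> (M j *v (K y *v h)))) \<le> \<alpha> * (h \<bullet> (M i *v h)))"
        and y: "y \<in> space \<mu>"
      obtain i where i: "y \<in> S i" using cases[OF y] by blast
      show "\<forall>h. (\<integral>x. g y x * ((K y *v h) \<bullet> (P x *v (K y *v h))) \<partial>\<mu>) \<le> \<alpha> * (h \<bullet> (P y *v h))"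
        unfolding P[OF i] unfolding P_def integral_piecewise_quadratic[OF S y] using * i by blast
    qed
  qed
  show ?thesis by (rule L_op_spectral_radius_le)
qed

end

lemma H_sup_norm_bound:
  fixes A :: "'a \<Rightarrow> real^'m^'n"
  assumes "A \<in> H_sup \<mu>"
  obtains c where "AE x in \<mu>. norm (A x) \<le> c"
proof -
  obtain c where "AE x in \<mu>. mat_norm (A x) \<le> c" using assms by (auto simp: H_sup_def)
  then have "AE x in \<mu>. norm (A x) \<le> real (CARD('n) * CARD('m)) * c"
    by eventually_elim (rule order_trans[OF norm_le_mat_norm], simp add: mult_left_mono)
  then show ?thesis by (rule that)
qed

lemma piecewise_in_H_sup:
  fixes M :: "'k::finite \<Rightarrow> real^'m^'n"
  assumes S: "\<And>j. S j \<in> sets \<mu>" and disj: "disjoint_family S" and cover: "(\<Union>j. S j) = space \<mu>"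
    and F: "\<And>i x. x \<in> S i \<Longrightarrow> F x = M i"
  shows "F \<in> H_sup \<mu>"
  unfolding H_sup_def
proof (intro CollectI conjI exI AE_I2)
  have "F x = piecewise S M x" if "x \<in> space \<mu>" for x
    using cover that piecewise_eq[OF disj] F by (metis UN_E)
  then show "F \<in> borel_measurable \<mu>"
    using piecewise_measurable[of S \<mu> M, OF S] measurable_cong[of \<mu> F "piecewise S M" borel] by blast
  fix x assume "x \<in> space \<mu>"
  then obtain i where "x \<in> S i" using cover by blast
  then show "mat_norm (F x) \<le> (\<Sum>j\<in>UNIV. mat_norm (M j))"
    using member_le_sum[of i UNIV "\<lambda>j. mat_norm (M j)"] by (simp add: F mat_norm_nonneg)
qed

lemma closed_loop_norm_bound:
  fixes A :: "'a \<Rightarrow> real^'n^'n" and B :: "'a \<Rightarrow> real^'m^'n" and F :: "'a \<Rightarrow> real^'n^'m"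
  assumes "A \<in> H_sup \<mu>" "B \<in> H_sup \<mu>" "F \<in> H_sup \<mu>"
  obtains b where "AE x in \<mu>. norm (A x + B x ** F x) \<le> b"
proof -
  obtain a b f where "AE x in \<mu>. norm (A x) \<le> a" "AE x in \<mu>. norm (B x) \<le> b" "AE x in \<mu>. norm (F x) \<le> f"
    using H_sup_norm_bound assms by metis
  note bounds = this
  obtain c where c: "0 < c"
    "\<And>(M :: real^'m^'n) (N :: real^'n^'m). norm (M ** N) \<le> norm M * norm N * c"
    using bounded_bilinear.pos_bounded[OF bounded_bilinear_matrix_matrix] by blast
  from bounds have "AE x in \<mu>. norm (A x + B x ** F x) \<le> a + b * f * c"
  proof eventually_elim
    fix x assume *: "norm (A x) \<le> a" "norm (B x) \<le> b" "norm (F x) \<le> f"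
    have "norm (B x) * norm (F x) * c \<le> b * f * c"
      using * c(1) order_trans[OF norm_ge_zero *(2)] order_trans[OF norm_ge_zero *(3)]
      by (intro mult_mono mult_nonneg_nonneg) auto
    then show "norm (A x + B x ** F x) \<le> a + b * f * c"
      using * c(2)[of "B x" "F x"] norm_triangle_ineq[of "A x" "B x ** F x"] by linarith
  qed
  then show ?thesis by (rule that)
qed

theorem theorem5p2:
  fixes \<tau>min \<tau>max :: real
    and \<mu> :: "(real^'p) measure"
    and g :: "real^'p \<Rightarrow> real^'p \<Rightarrow> real"
    and A :: "real^'p \<Rightarrow> real^'n^'n"
    and B :: "real^'p \<Rightarrow> real^'m^'n"
    and Box :: "'k::finite \<Rightarrow> (real^'p) set"
    and c :: "'k \<Rightarrow> real^'p"
    and w :: "'k \<Rightarrow> real^'p \<Rightarrow> real"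
    and \<Gamma>A :: "'k \<Rightarrow> real^'n^('k \<times> 'n)"
    and \<Gamma>B :: "'k \<Rightarrow> real^'m^('k \<times> 'n)"
    and \<kappa> lam :: "'k \<Rightarrow> real"
    and R U :: "'k \<Rightarrow> real^'n^'n"
    and Fbar :: "'k \<Rightarrow> real^'n^'m"
    and F :: "real^'p \<Rightarrow> real^'n^'m"
  assumes sets_\<mu>: "sets \<mu> = sets (restrict_space borel (param_cube \<tau>min \<tau>max))"
    and sigma_finite: "sigma_finite_measure \<mu>"
    and g: "transition_density \<mu> g"
    and A: "A \<in> H_sup \<mu>"
    and B: "B \<in> H_sup \<mu>"
    and boxes: "\<And>i. is_box (Box i)"
    and disjoint: "disjoint_family Box"
    and cover: "(\<Union>i. Box i) = param_cube \<tau>min \<tau>max"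
    and c: "\<And>i. c i \<in> Box i"
    and w: "\<And>i \<phi>. \<phi> \<in> param_cube \<tau>min \<tau>max \<Longrightarrow> w i \<phi> = (LINT l:Box i|\<mu>. g \<phi> l)"
    and \<Gamma>A: "\<And>i. \<Gamma>A i = weighted_stack (\<lambda>j. w j (c i)) (A (c i))"
    and \<Gamma>B: "\<And>i. \<Gamma>B i = weighted_stack (\<lambda>j. w j (c i)) (B (c i))"
    and \<kappa>_pos: "\<And>i. 0 < \<kappa> i"
    and \<kappa>: "\<And>i. AE \<phi> in \<mu>. \<phi> \<in> Box i \<longrightarrow>
        mat_norm (hcat (weighted_stack (\<lambda>j. w j \<phi>) (A \<phi>)) (weighted_stack (\<lambda>j. w j \<phi>) (B \<phi>))
                  - hcat (\<Gamma>A i) (\<Gamma>B i)) \<le> \<kappa> i"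
    and R: "\<And>i. pos_def (R i)"
    and lam_pos: "\<And>i. 0 < lam i"
    and LMI: "\<And>i. pos_def
        (lmi_matrix (R i) (U i) (Fbar i) (\<Gamma>A i) (\<Gamma>B i) (\<kappa> i) (lam i) (block_diag R))"
    and F: "\<And>i \<phi>. \<phi> \<in> Box i \<Longrightarrow> F \<phi> = Fbar i ** matrix_inv (U i)"
  shows "stoch_stabilizable_by \<mu> g A B F"
proof -
  have space: "space \<mu> = param_cube \<tau>min \<tau>max"
    using sets_eq_imp_space_eq[OF sets_\<mu>] by (simp add: space_restrict_space)
  have Box: "Box j \<in> sets \<mu>" for j
  proof -
    have "Box j = param_cube \<tau>min \<tau>max \<inter> Box j" using cover by blast
    then show ?thesis
      unfolding sets_\<mu> sets_restrict_space using is_box_borel[OF boxes] by blast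
  qed
  have cover': "(\<Union>j. Box j) = space \<mu>" by (simp add: space cover)
  define K where "K = (\<lambda>x. A x + B x ** F x)"
  have F_sup: "F \<in> H_sup \<mu>"
    by (rule piecewise_in_H_sup[OF Box disjoint cover' F])
  obtain b where b: "AE x in \<mu>. norm (K x) \<le> b"
    unfolding K_def using closed_loop_norm_bound[OF A B F_sup] by blast
  have K: "K \<in> borel_measurable \<mu>"
    unfolding K_def using A B F_sup by (auto simp: H_sup_def)
  interpret weighted_chain \<mu> g K b
    by (intro weighted_chain.intro weighted_chain_axioms.intro sigma_finite g K b)
  define contracts where "contracts = (\<lambda>i a. \<forall>A B v h. (\<forall>j. 0 \<le> v j) \<longrightarrow>
      mat_norm (hcat (weighted_stack v A) (weighted_stack v B) - hcat (\<Gamma>A i) (\<Gamma>B i)) \<le> \<kappa> i \<longrightarrow>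
      (\<Sum>j\<in>UNIV. v j * (((A + B ** (Fbar i ** matrix_inv (U i))) *v h)
          \<bullet> (matrix_inv (R j) *v ((A + B ** (Fbar i ** matrix_inv (U i))) *v h))))
        \<le> a * (h \<bullet> (matrix_inv (R i) *v h)))"
  have "\<exists>a. 0 \<le> a \<and> a < 1 \<and> contracts i a" for i
  proof (rule closed_loop_contraction[OF LMI[of i] R lam_pos[of i] less_imp_le[OF \<kappa>_pos[of i]]])
    fix a :: real
    assume "0 \<le> a" "a < 1" and *: "\<And>A B v h. (\<And>j. 0 \<le> v j) \<Longrightarrow>
      mat_norm (hcat (weighted_stack v A) (weighted_stack v B) - hcat (\<Gamma>A i) (\<Gamma>B i)) \<le> \<kappa> i \<Longrightarrow>
      (\<Sum>j\<in>UNIV. v j * (((A + B ** (Fbar i ** matrix_inv (U i))) *v h)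
          \<bullet> (matrix_inv (R j) *v ((A + B ** (Fbar i ** matrix_inv (U i))) *v h))))
        \<le> a * (h \<bullet> (matrix_inv (R i) *v h))"
    have "contracts i a" unfolding contracts_def by (intro allI impI *) auto
    with \<open>0 \<le> a\<close> \<open>a < 1\<close> show ?thesis by blast
  qed
  then obtain a where a: "\<And>i. 0 \<le> a i" "\<And>i. a i < 1" and contr: "\<And>i. contracts i (a i)"
    by metis
  define \<alpha> where "\<alpha> = Max (range a)"
  have \<alpha>_less: "\<alpha> < 1" and a_le: "a i \<le> \<alpha>" for i using a(2) by (simp_all add: \<alpha>_def)
  have \<alpha>: "0 \<le> \<alpha>" using order_trans[OF a(1) a_le] .
  have "H1C_spectral_radius \<mu> (L_op \<mu> g K) \<le> ennreal \<alpha>"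
  proof (rule piecewise_lyapunov_spectral_radius[OF Box disjoint cover' pos_def_inverse(2)[OF R] \<alpha>])
    fix i
    show "AE y in \<mu>. y \<in> Box i \<longrightarrow> (\<forall>h.
        (\<Sum>j\<in>UNIV. (LINT x:Box j|\<mu>. g y x) * ((K y *v h) \<bullet> (matrix_inv (R j) *v (K y *v h))))
          \<le> \<alpha> * (h \<bullet> (matrix_inv (R i) *v h)))"
      using \<kappa>[of i] AE_space
    proof eventually_elim
      fix y
      assume close: "y \<in> Box i \<longrightarrow> mat_norm (hcat (weighted_stack (\<lambda>j. w j y) (A y))
          (weighted_stack (\<lambda>j. w j y) (B y)) - hcat (\<Gamma>A i) (\<Gamma>B i)) \<le> \<kappa> i"
        and y: "y \<in> space \<mu>"
      have wy: "w j y = (LINT x:Box j|\<mu>. g y x)" for j using w y by (simp add: space)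
      show "y \<in> Box i \<longrightarrow> (\<forall>h.
          (\<Sum>j\<in>UNIV. (LINT x:Box j|\<mu>. g y x) * ((K y *v h) \<bullet> (matrix_inv (R j) *v (K y *v h))))
            \<le> \<alpha> * (h \<bullet> (matrix_inv (R i) *v h)))"
      proof (intro impI allI)
        fix h assume yi: "y \<in> Box i"
        have "(\<Sum>j\<in>UNIV. w j y * ((K y *v h) \<bullet> (matrix_inv (R j) *v (K y *v h))))
            \<le> a i * (h \<bullet> (matrix_inv (R i) *v h))"
          unfolding K_def F[OF yi]
          by (rule contr[unfolded contracts_def, rule_format])
            (use close yi set_integral_g_nonneg[OF y] in \<open>simp_all add: wy\<close>)
        also have "\<dots> \<le> \<alpha> * (h \<bullet> (matrix_inv (R i) *v h))"
          using pos_def_inverse(2)[OF R, of h i]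
          by (intro mult_right_mono a_le) (cases "h = 0"; simp)
        finally show "(\<Sum>j\<in>UNIV. (LINT x:Box j|\<mu>. g y x) * ((K y *v h) \<bullet> (matrix_inv (R j) *v (K y *v h))))
            \<le> \<alpha> * (h \<bullet> (matrix_inv (R i) *v h))"
          by (simp add: wy)
      qed
    qed
  qed
  also have "ennreal \<alpha> < 1" using \<alpha>_less \<alpha> by (simp add: ennreal_less_one_iff)
  finally show ?thesis
    unfolding stoch_stabilizable_by_def using F_sup by (simp add: K_def[symmetric])
qed

end
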